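(* Let $\Sigma$ be the hyperelliptic Riemann surface of $y^2=\omega^8-14\omega^4+1$, let $\lambda\in\mathbb{C}$, and let $$\Phi_1=\frac{1-(1+\lambda^2)\omega^2}{y}\,d\omega,\quad \Phi_2=\frac{i\,(1+(1+\lambda^2)\omega^2)}{y}\,d\omega,\quad \Phi_3=\frac{2\omega}{y}\,d\omega,\quad \Phi_4=\frac{2\lambda\omega}{y}\,d\omega$$ be the associated holomorphic $1$-forms on $\Sigma$. Let $\sigma:\Sigma\to\Sigma$ be the automorphism $\sigma(\omega,y)=(i\omega,y)$. Then $$\sigma^*\Phi_1=\Phi_2,\qquad \sigma^*\Phi_2=-\Phi_1,\qquad \sigma^*\Phi_3=-\Phi_3,\qquad \sigma^*\Phi_4=-\Phi_4.$$ Equivalently, with $\Phi=(\Phi_1,\Phi_2,\Phi_3,\Phi_4)^{T}$ viewed as a column vector of $1$-forms, $\sigma^*\Phi=M\Phi$, where $$M=\begin{pmatrix}0&1&0&0\\-1&0&0&0\\0&0&-1&0\\0&0&0&-1\end{pmatrix}\in U(4).$$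
   Context: The automorphism $\sigma$ is well defined because $\omega^8-14\omega^4+1$ is invariant under $\omega\mapsto i\omega$. The forms $\Phi_j$ arise from the Weierstrass data $f=2/y$, $g_1=\omega$, $g_2=\lambda\omega$ via $\Phi_1=\tfrac12 f(1-g_1^2-g_2^2)\,d\omega$, $\Phi_2=\tfrac i2 f(1+g_1^2+g_2^2)\,d\omega$, $\Phi_3=fg_1\,d\omega$, $\Phi_4=fg_2\,d\omega$. The pullback $\sigma^*\Phi_j$ is the pullback of the $1$-form, including that of $d\omega$. *)

theory Defs
  imports "HOL-Complex_Analysis.Complex_Analysis" "HOL-Library.Function_Algebras"
begin

section \<open>Riemann surfaces, holomorphic maps and 1-forms\<close>

text \<open>A chart is a pair \<open>(U, \<phi>)\<close>; only the values of \<open>\<phi>\<close> on \<open>U\<close> matter.\<close>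

type_synonym 'a chart = "'a set \<times> ('a \<Rightarrow> complex)"

definition complex_atlas :: "'a set \<Rightarrow> 'a chart set \<Rightarrow> bool" where
  "complex_atlas X A \<longleftrightarrow>
     \<Union> (fst ` A) = X \<and>
     (\<forall>(U, \<phi>) \<in> A. inj_on \<phi> U \<and> open (\<phi> ` U)) \<and>
     (\<forall>(U, \<phi>) \<in> A. \<forall>(V, \<psi>) \<in> A.
        open (\<phi> ` (U \<inter> V)) \<and> (\<psi> \<circ> inv_into U \<phi>) holomorphic_on \<phi> ` (U \<inter> V))"

definition atlas_topology :: "'a chart set \<Rightarrow> 'a topology" where
  "atlas_topology A =
     topology (\<lambda>S. S \<subseteq> \<Union> (fst ` A) \<and> (\<forall>(U, \<phi>) \<in> A. open (\<phi> ` (S \<inter> U))))"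

definition riemann_surface :: "'a set \<Rightarrow> 'a chart set \<Rightarrow> bool" where
  "riemann_surface X A \<longleftrightarrow>
     complex_atlas X A \<and> Hausdorff_space (atlas_topology A) \<and> connected_space (atlas_topology A)"

text \<open>Openness of \<open>\<phi> ` (U \<inter> F -` V)\<close> for all charts expresses continuity of \<open>F\<close>.\<close>

definition holomorphic_map ::
    "'a set \<Rightarrow> 'a chart set \<Rightarrow> 'b set \<Rightarrow> 'b chart set \<Rightarrow> ('a \<Rightarrow> 'b) \<Rightarrow> bool" where
  "holomorphic_map X A Y B F \<longleftrightarrow>
     F ` X \<subseteq> Y \<and>
     (\<forall>(U, \<phi>) \<in> A. \<forall>(V, \<psi>) \<in> B.
        open (\<phi> ` (U \<inter> F -` V)) \<and>
        (\<psi> \<circ> F \<circ> inv_into U \<phi>) holomorphic_on \<phi> ` (U \<inter> F -` V))"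

definition surface_automorphism :: "'a set \<Rightarrow> 'a chart set \<Rightarrow> ('a \<Rightarrow> 'a) \<Rightarrow> bool" where
  "surface_automorphism X A F \<longleftrightarrow>
     bij_betw F X X \<and> holomorphic_map X A X A F \<and> holomorphic_map X A X A (inv_into X F)"

text \<open>A 1-form is its family of local coefficients: in the chart \<open>c = (U, \<phi>)\<close> with coordinate
  \<open>z\<close> the form \<open>\<alpha>\<close> reads \<open>\<alpha> c z dz\<close>.  Coefficients are \<open>0\<close> outside of \<open>\<phi> ` U\<close> and for pairs
  that are not charts of the atlas, so that equality of 1-forms is equality in HOL.\<close>

type_synonym 'a one_form = "'a chart \<Rightarrow> complex \<Rightarrow> complex"

definition holomorphic_one_form :: "'a chart set \<Rightarrow> 'a one_form \<Rightarrow> bool" where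
  "holomorphic_one_form A \<alpha> \<longleftrightarrow>
     (\<forall>(U, \<phi>) \<in> A. \<alpha> (U, \<phi>) holomorphic_on \<phi> ` U) \<and>
     (\<forall>(U, \<phi>) \<in> A. \<forall>(V, \<psi>) \<in> A. \<forall>z \<in> \<phi> ` (U \<inter> V).
        \<alpha> (U, \<phi>) z = \<alpha> (V, \<psi>) ((\<psi> \<circ> inv_into U \<phi>) z) * deriv (\<psi> \<circ> inv_into U \<phi>) z) \<and>
     (\<forall>U \<phi> z. (U, \<phi>) \<notin> A \<or> z \<notin> \<phi> ` U \<longrightarrow> \<alpha> (U, \<phi>) z = 0)"

text \<open>The 1-form \<open>g dh\<close> for meromorphic functions \<open>g\<close>, \<open>h\<close>, which take arbitrary values at their
  poles: the local coefficient is the one of \<open>g dh\<close>, extended over its removable singularities.\<close>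

definition differential ::
    "'a chart set \<Rightarrow> ('a \<Rightarrow> complex) \<Rightarrow> ('a \<Rightarrow> complex) \<Rightarrow> 'a one_form" where
  "differential A g h = (\<lambda>(U, \<phi>) z.
     if (U, \<phi>) \<in> A \<and> z \<in> \<phi> ` U
     then remove_sings (\<lambda>t. g (inv_into U \<phi> t) * deriv (h \<circ> inv_into U \<phi>) t) z
     else 0)"

text \<open>Pullback \<open>F\<^sup>*\<alpha>\<close> along \<open>F\<close>, from the surface with atlas \<open>A\<close> to the one with atlas \<open>B\<close>.  For a
  form \<open>\<alpha>\<close> and a holomorphic \<open>F\<close> the choice of the chart around the image point is irrelevant.\<close>

definition pullback ::
    "'a chart set \<Rightarrow> 'b chart set \<Rightarrow> ('a \<Rightarrow> 'b) \<Rightarrow> 'b one_form \<Rightarrow> 'a one_form" where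
  "pullback A B F \<alpha> = (\<lambda>(U, \<phi>) z.
     if (U, \<phi>) \<in> A \<and> z \<in> \<phi> ` U
     then (let p = inv_into U \<phi> z; (V, \<psi>) = (SOME c. c \<in> B \<and> F p \<in> fst c)
           in \<alpha> (V, \<psi>) (\<psi> (F p)) * deriv (\<psi> \<circ> F \<circ> inv_into U \<phi>) z)
     else 0)"

definition mat_mult_forms :: "complex^'n^'m \<Rightarrow> 'a one_form^'n \<Rightarrow> 'a one_form^'m" where
  "mat_mult_forms M \<Phi> = (\<chi> i. (\<lambda>c z. \<Sum>j\<in>UNIV. M $ i $ j * (\<Phi> $ j) c z))"

definition unitary_matrix :: "complex^'n^'n \<Rightarrow> bool" where
  "unitary_matrix M \<longleftrightarrow>
     M ** (\<chi> i j. cnj (M $ j $ i)) = mat 1 \<and> (\<chi> i j. cnj (M $ j $ i)) ** M = mat 1"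


section \<open>The hyperelliptic surface\<close>

definition surf_poly :: "complex \<Rightarrow> complex" where
  "surf_poly w = w ^ 8 - 14 * w ^ 4 + 1"

text \<open>The compact surface consists of the affine curve and of two points over \<open>\<omega> = \<infinity>\<close>.  With
  \<open>u = 1 / \<omega>\<close> and \<open>v = y / \<omega>^4\<close> the curve is \<open>v\<^sup>2 = 1 - 14 u^4 + u^8\<close> near \<open>\<omega> = \<infinity>\<close>, and
  \<open>At_inf v\<close> is the point with coordinates \<open>u = 0\<close> and \<open>v\<close>.\<close>

datatype surf_point = Affine complex complex | At_inf complex

definition surf :: "surf_point set" where
  "surf = {Affine w y | w y. y\<^sup>2 = surf_poly w} \<union> {At_inf v | v. v\<^sup>2 = 1}"

text \<open>Both \<open>\<omega>\<close> and \<open>y\<close> have poles at the two points over infinity, where the value \<open>0\<close> is a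
  placeholder.\<close>

fun fun_w :: "surf_point \<Rightarrow> complex" where
  "fun_w (Affine w y) = w"
| "fun_w (At_inf v) = 0"

fun fun_y :: "surf_point \<Rightarrow> complex" where
  "fun_y (Affine w y) = y"
| "fun_y (At_inf v) = 0"

fun fun_u :: "surf_point \<Rightarrow> complex" where
  "fun_u (Affine w y) = 1 / w"
| "fun_u (At_inf v) = 0"

definition point_uv :: "complex \<Rightarrow> complex \<Rightarrow> surf_point" where
  "point_uv u v = (if u = 0 then At_inf v else Affine (1 / u) (v / u ^ 4))"

text \<open>The charts are the inverses of local holomorphic sections of \<open>\<omega>\<close>, \<open>y\<close> and \<open>u\<close>, which cover
  the points with \<open>y \<noteq> 0\<close>, the branch points and the points at infinity, respectively.\<close>

definition surf_atlas :: "surf_point chart set" where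
  "surf_atlas =
     {((\<lambda>w. Affine w (s w)) ` D, fun_w) | s D.
        open D \<and> s holomorphic_on D \<and> (\<forall>w\<in>D. (s w)\<^sup>2 = surf_poly w)} \<union>
     {((\<lambda>y. Affine (h y) y) ` D, fun_y) | h D.
        open D \<and> h holomorphic_on D \<and> (\<forall>y\<in>D. y\<^sup>2 = surf_poly (h y))} \<union>
     {((\<lambda>u. point_uv u (s u)) ` D, fun_u) | s D.
        open D \<and> s holomorphic_on D \<and> (\<forall>u\<in>D. (s u)\<^sup>2 = 1 - 14 * u ^ 4 + u ^ 8)}"

definition Phi1 :: "complex \<Rightarrow> surf_point one_form" where
  "Phi1 l = differential surf_atlas (\<lambda>p. (1 - (1 + l\<^sup>2) * (fun_w p)\<^sup>2) / fun_y p) fun_w"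

definition Phi2 :: "complex \<Rightarrow> surf_point one_form" where
  "Phi2 l = differential surf_atlas (\<lambda>p. \<i> * (1 + (1 + l\<^sup>2) * (fun_w p)\<^sup>2) / fun_y p) fun_w"

definition Phi3 :: "complex \<Rightarrow> surf_point one_form" where
  "Phi3 l = differential surf_atlas (\<lambda>p. 2 * fun_w p / fun_y p) fun_w"

definition Phi4 :: "complex \<Rightarrow> surf_point one_form" where
  "Phi4 l = differential surf_atlas (\<lambda>p. 2 * l * fun_w p / fun_y p) fun_w"

definition Phi :: "complex \<Rightarrow> surf_point one_form^4" where
  "Phi l = vector [Phi1 l, Phi2 l, Phi3 l, Phi4 l]"

text \<open>On points at infinity \<open>(\<omega>, y) \<mapsto> (\<i> \<omega>, y)\<close> reads \<open>(u, v) \<mapsto> (- \<i> u, v)\<close>, which fixes both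
  of them.\<close>

fun sigma_aut :: "surf_point \<Rightarrow> surf_point" where
  "sigma_aut (Affine w y) = Affine (\<i> * w) y"
| "sigma_aut (At_inf v) = At_inf v"

definition M_sigma :: "complex^4^4" where
  "M_sigma = vector [vector [0, 1, 0, 0],
                     vector [-1, 0, 0, 0],
                     vector [0, 0, -1, 0],
                     vector [0, 0, 0, -1]]"


section \<open>Well-definedness\<close>

text \<open>The remaining facts only confirm that the objects above are what their names say:
  \<open>surf_riemann_surface\<close>, \<open>sigma_automorphism\<close> and \<open>Phi_holomorphic\<close>.\<close>

subsection \<open>Holomorphic curves in the surface\<close>

definition fun_v :: "surf_point \<Rightarrow> complex" where
  "fun_v p = (case p of Affine w y \<Rightarrow> y / w ^ 4 | At_inf v \<Rightarrow> v)"

lemma fun_v_simps [simp]: "fun_v (Affine w y) = y / w ^ 4" "fun_v (At_inf v) = v"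
  by (simp_all add: fun_v_def)

definition affine_pts :: "surf_point set" where
  "affine_pts = {Affine w y | w y. y\<^sup>2 = surf_poly w}"

definition outer_pts :: "surf_point set" where
  "outer_pts = {Affine w y | w y. w \<noteq> 0 \<and> y\<^sup>2 = surf_poly w} \<union> {At_inf v | v. v\<^sup>2 = 1}"

text \<open>\<open>reg r z\<close>: near \<open>z\<close> the map \<open>r\<close> is a holomorphic curve in the surface, as seen in the
  affine coordinates \<open>(\<omega>, y)\<close> or in the coordinates \<open>(u, v)\<close>.\<close>

definition areg :: "(complex \<Rightarrow> surf_point) \<Rightarrow> complex \<Rightarrow> bool" where
  "areg r z \<longleftrightarrow> (\<forall>\<^sub>F t in nhds z. r t \<in> affine_pts) \<and>
     (\<lambda>t. fun_w (r t)) analytic_on {z} \<and> (\<lambda>t. fun_y (r t)) analytic_on {z}"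

definition ireg :: "(complex \<Rightarrow> surf_point) \<Rightarrow> complex \<Rightarrow> bool" where
  "ireg r z \<longleftrightarrow> (\<forall>\<^sub>F t in nhds z. r t \<in> outer_pts) \<and>
     (\<lambda>t. fun_u (r t)) analytic_on {z} \<and> (\<lambda>t. fun_v (r t)) analytic_on {z}"

definition reg :: "(complex \<Rightarrow> surf_point) \<Rightarrow> complex \<Rightarrow> bool" where
  "reg r z \<longleftrightarrow> areg r z \<or> ireg r z"

lemma surf_eq: "surf = affine_pts \<union> outer_pts"
  by (auto simp: surf_def affine_pts_def outer_pts_def)

lemma poly_inv:
  assumes "u \<noteq> 0"
  shows "surf_poly (1 / u) = (1 - 14 * u ^ 4 + u ^ 8) / u ^ 8"
proof -
  have "u ^ 8 = u ^ 4 * u ^ 4" by (simp flip: power_add)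
  then show ?thesis using assms by (simp add: surf_poly_def power_divide field_simps)
qed

lemma an_cong: "f analytic_on {z} \<Longrightarrow> \<forall>\<^sub>F t in nhds z. f t = g t \<Longrightarrow> g analytic_on {z}"
  for f g :: "complex \<Rightarrow> complex"
  using analytic_at_cong[of f g z z] by simp

lemma affine_iff [simp]: "Affine w y \<in> affine_pts \<longleftrightarrow> y\<^sup>2 = surf_poly w" "At_inf v \<notin> affine_pts"
  by (auto simp: affine_pts_def)

lemma outer_iff [simp]: "Affine w y \<in> outer_pts \<longleftrightarrow> w \<noteq> 0 \<and> y\<^sup>2 = surf_poly w"
    "At_inf v \<in> outer_pts \<longleftrightarrow> v\<^sup>2 = 1"
  by (auto simp: outer_pts_def)

lemma surf_iff [simp]: "Affine w y \<in> surf \<longleftrightarrow> y\<^sup>2 = surf_poly w" "At_inf v \<in> surf \<longleftrightarrow> v\<^sup>2 = 1"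
  by (auto simp: surf_def)

lemma ev_ne:
  fixes f :: "complex \<Rightarrow> complex"
  assumes "f analytic_on {z}" "f z \<noteq> c"
  shows "\<forall>\<^sub>F t in nhds z. f t \<noteq> c"
  using analytic_at_neq_imp_eventually_neq[OF assms] assms(2)
  by (auto simp: eventually_at_filter elim!: eventually_mono)

lemma ev_at: "\<forall>\<^sub>F t in nhds z. P t \<Longrightarrow> P z"
  by (rule eventually_nhds_x_imp_x)

lemma areg_imp_ireg:
  assumes "areg r z" "r z \<in> outer_pts"
  shows "ireg r z"
proof -
  have aff: "\<forall>\<^sub>F t in nhds z. r t \<in> affine_pts" and w: "(\<lambda>t. fun_w (r t)) analytic_on {z}"
    and y: "(\<lambda>t. fun_y (r t)) analytic_on {z}"
    using assms by (auto simp: areg_def)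
  have "r z \<in> affine_pts" using ev_at[OF aff] .
  then have w0: "fun_w (r z) \<noteq> 0" using assms(2) by (cases "r z") auto
  have ne: "\<forall>\<^sub>F t in nhds z. fun_w (r t) \<noteq> 0" by (rule ev_ne[OF w w0])
  have "\<forall>\<^sub>F t in nhds z. r t \<in> outer_pts"
    using aff ne by eventually_elim (auto simp: affine_pts_def)
  moreover have "(\<lambda>t. 1 / fun_w (r t)) analytic_on {z}"
    using w w0 by (auto intro!: analytic_intros)
  moreover have "\<forall>\<^sub>F t in nhds z. 1 / fun_w (r t) = fun_u (r t)"
    using aff by eventually_elim (auto simp: affine_pts_def)
  moreover have "(\<lambda>t. fun_y (r t) / fun_w (r t) ^ 4) analytic_on {z}"
    using w w0 y by (auto intro!: analytic_intros)
  moreover have "\<forall>\<^sub>F t in nhds z. fun_y (r t) / fun_w (r t) ^ 4 = fun_v (r t)"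
    using aff by eventually_elim (auto simp: affine_pts_def)
  ultimately show ?thesis
    unfolding ireg_def by (blast intro: an_cong)
qed

lemma ireg_imp_areg:
  assumes "ireg r z" "r z \<in> affine_pts"
  shows "areg r z"
proof -
  have out: "\<forall>\<^sub>F t in nhds z. r t \<in> outer_pts" and u: "(\<lambda>t. fun_u (r t)) analytic_on {z}"
    and v: "(\<lambda>t. fun_v (r t)) analytic_on {z}"
    using assms by (auto simp: ireg_def)
  have "r z \<in> outer_pts" using ev_at[OF out] .
  then have u0: "fun_u (r z) \<noteq> 0" using assms(2) by (cases "r z") auto
  have ne: "\<forall>\<^sub>F t in nhds z. fun_u (r t) \<noteq> 0" by (rule ev_ne[OF u u0])
  have "\<forall>\<^sub>F t in nhds z. r t \<in> affine_pts"
    using out ne by eventually_elim (auto simp: outer_pts_def)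
  moreover have "(\<lambda>t. 1 / fun_u (r t)) analytic_on {z}"
    using u u0 by (auto intro!: analytic_intros)
  moreover have "\<forall>\<^sub>F t in nhds z. 1 / fun_u (r t) = fun_w (r t)"
    using out ne by eventually_elim (auto simp: outer_pts_def)
  moreover have "(\<lambda>t. fun_v (r t) / fun_u (r t) ^ 4) analytic_on {z}"
    using u u0 v by (auto intro!: analytic_intros)
  moreover have "\<forall>\<^sub>F t in nhds z. fun_v (r t) / fun_u (r t) ^ 4 = fun_y (r t)"
    using out ne by eventually_elim (auto simp: outer_pts_def divide_simps)
  ultimately show ?thesis
    unfolding areg_def by (blast intro: an_cong)
qed

lemma reg_areg: "reg r z \<Longrightarrow> r z \<in> affine_pts \<Longrightarrow> areg r z"
  using ireg_imp_areg reg_def by blast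

lemma reg_ireg: "reg r z \<Longrightarrow> r z \<in> outer_pts \<Longrightarrow> ireg r z"
  using areg_imp_ireg reg_def by blast

lemma reg_surf: "reg r z \<Longrightarrow> \<forall>\<^sub>F t in nhds z. r t \<in> surf"
  unfolding reg_def areg_def ireg_def surf_eq by (auto elim!: eventually_mono)

lemma reg_cong:
  assumes "\<forall>\<^sub>F t in nhds z. r t = q t" "reg r z"
  shows "reg q z"
proof -
  have 1: "(\<lambda>t. f (q t)) analytic_on {z}" if "(\<lambda>t. f (r t)) analytic_on {z}" for f :: "_ \<Rightarrow> complex"
  proof -
    have "\<forall>\<^sub>F t in nhds z. f (r t) = f (q t)"
      using assms(1) by eventually_elim simp
    then show ?thesis by (rule an_cong[OF that])
  qed
  have 2: "\<forall>\<^sub>F t in nhds z. q t \<in> S" if "\<forall>\<^sub>F t in nhds z. r t \<in> S" for S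
    using assms(1) that by eventually_elim simp
  show ?thesis using assms(2) 1 2 unfolding reg_def areg_def ireg_def by blast
qed

lemma atlas_cases:
  assumes "c \<in> surf_atlas"
  obtains (w) s D where "c = ((\<lambda>w. Affine w (s w)) ` D, fun_w)" "open D" "s holomorphic_on D"
        "\<forall>w\<in>D. (s w)\<^sup>2 = surf_poly w"
    | (y) h D where "c = ((\<lambda>y. Affine (h y) y) ` D, fun_y)" "open D" "h holomorphic_on D"
        "\<forall>y\<in>D. y\<^sup>2 = surf_poly (h y)"
    | (u) s D where "c = ((\<lambda>u. point_uv u (s u)) ` D, fun_u)" "open D" "s holomorphic_on D"
        "\<forall>u\<in>D. (s u)\<^sup>2 = 1 - 14 * u ^ 4 + u ^ 8"
  using assms unfolding surf_atlas_def Un_iff mem_Collect_eq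
  by (elim disjE exE conjE) (erule (3) w y u)+

lemma section_props:
  assumes "\<And>z. z \<in> D \<Longrightarrow> \<phi> (p z) = z"
  shows "inj_on \<phi> (p ` D)" "\<phi> ` p ` D = D" "z \<in> D \<Longrightarrow> inv_into (p ` D) \<phi> z = p z"
proof -
  show 1: "inj_on \<phi> (p ` D)" using assms by (auto simp: inj_on_def)
  show "\<phi> ` p ` D = D" using assms by (auto simp: image_iff)
  show "inv_into (p ` D) \<phi> z = p z" if "z \<in> D"
    using inv_into_f_f[OF 1, of "p z"] that assms by auto
qed

lemma fun_u_point_uv [simp]: "fun_u (point_uv u v) = u"
  by (simp add: point_uv_def)

lemma fun_v_point_uv [simp]: "fun_v (point_uv u v) = v"
  by (simp add: point_uv_def divide_simps)

lemma point_uv_outer: "v\<^sup>2 = 1 - 14 * u ^ 4 + u ^ 8 \<Longrightarrow> point_uv u v \<in> outer_pts"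
  by (auto simp: point_uv_def poly_inv power_divide simp flip: power_mult)

lemma chart_inj_open:
  assumes "(U, \<phi>) \<in> surf_atlas"
  shows "inj_on \<phi> U" "open (\<phi> ` U)"
  using assms by (cases rule: atlas_cases; auto simp: section_props)+

lemma chart_reg:
  assumes "(U, \<phi>) \<in> surf_atlas" "z \<in> \<phi> ` U"
  shows "reg (inv_into U \<phi>) z"
  using assms(1)
proof (cases rule: atlas_cases)
  case (w s D)
  let ?p = "\<lambda>w. Affine w (s w)"
  have c: "U = ?p ` D" "\<phi> = fun_w" using w by auto
  have z: "z \<in> D" using assms(2) by (auto simp: c)
  have ev: "\<forall>\<^sub>F t in nhds z. t \<in> D" using z w(2) by (simp add: eventually_nhds_in_open)
  have rg: "areg ?p z"
    unfolding areg_def using w z ev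
    by (auto intro!: analytic_intros holomorphic_on_imp_analytic_at[of s D] elim!: eventually_mono)
  have "\<forall>\<^sub>F t in nhds z. ?p t = inv_into U \<phi> t"
    using ev unfolding c by eventually_elim (simp add: section_props(3)[of D fun_w ?p])
  then show ?thesis by (rule reg_cong) (use rg reg_def in blast)
next
  case (y h D)
  let ?p = "\<lambda>y. Affine (h y) y"
  have c: "U = ?p ` D" "\<phi> = fun_y" using y by auto
  have z: "z \<in> D" using assms(2) by (auto simp: c)
  have ev: "\<forall>\<^sub>F t in nhds z. t \<in> D" using z y(2) by (simp add: eventually_nhds_in_open)
  have rg: "areg ?p z"
    unfolding areg_def using y z ev
    by (auto intro!: analytic_intros holomorphic_on_imp_analytic_at[of h D] elim!: eventually_mono)
  have "\<forall>\<^sub>F t in nhds z. ?p t = inv_into U \<phi> t"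
    using ev unfolding c by eventually_elim (simp add: section_props(3)[of D fun_y ?p])
  then show ?thesis by (rule reg_cong) (use rg reg_def in blast)
next
  case (u s D)
  let ?p = "\<lambda>u. point_uv u (s u)"
  have c: "U = ?p ` D" "\<phi> = fun_u" using u by auto
  have z: "z \<in> D" using assms(2) by (auto simp: c)
  have ev: "\<forall>\<^sub>F t in nhds z. t \<in> D" using z u(2) by (simp add: eventually_nhds_in_open)
  have rg: "ireg ?p z"
    unfolding ireg_def using u z ev
    by (auto intro!: analytic_intros point_uv_outer holomorphic_on_imp_analytic_at[of s D] elim!: eventually_mono)
  have "\<forall>\<^sub>F t in nhds z. ?p t = inv_into U \<phi> t"
    using ev unfolding c by eventually_elim (simp add: section_props(3)[of D fun_u ?p])
  then show ?thesis by (rule reg_cong) (use rg reg_def in blast)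
qed

definition surf_poly' :: "complex \<Rightarrow> complex" where
  "surf_poly' w = 8 * w ^ 7 - 56 * w ^ 3"

lemma surf_poly_deriv: "(surf_poly has_field_derivative surf_poly' w) (at w within S)"
  unfolding surf_poly_def surf_poly'_def by (auto intro!: derivative_eq_intros)

lemma surf_poly_holo: "surf_poly holomorphic_on S"
  unfolding surf_poly_def by (intro holomorphic_intros)

lemma surf_poly_simple: "surf_poly w = 0 \<Longrightarrow> surf_poly' w \<noteq> 0"
proof
  assume a: "surf_poly w = 0" "surf_poly' w = 0"
  have "w ^ 3 * (w ^ 4 - 7) = 0" using a(2) by (simp add: surf_poly'_def algebra_simps flip: power_add)
  then have w: "w = 0 \<or> w ^ 4 = 7" by auto
  have "surf_poly w = w ^ 4 * w ^ 4 - 14 * w ^ 4 + 1"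
    by (simp add: surf_poly_def flip: power_add)
  then have q: "w ^ 4 * w ^ 4 - 14 * w ^ 4 + 1 = 0" using a(1) by simp
  have "w \<noteq> 0" using q by auto
  with w have "w ^ 4 = 7" by simp
  show False using q unfolding \<open>w ^ 4 = 7\<close> by simp
qed

lemma w_section_nz:
  assumes "open D" "s holomorphic_on D" "\<forall>w\<in>D. (s w)\<^sup>2 = surf_poly w" "w \<in> D"
  shows "s w \<noteq> 0"
proof
  assume s0: "s w = 0"
  have ds: "(s has_field_derivative deriv s w) (at w)"
    using assms by (auto intro: holomorphic_derivI)
  have "((\<lambda>t. (s t)\<^sup>2) has_field_derivative 0) (at w)"
    using s0 by (auto intro!: derivative_eq_intros ds)
  moreover have "((\<lambda>t. (s t)\<^sup>2) has_field_derivative surf_poly' w) (at w)"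
  proof (rule has_field_derivative_transform_within_open[OF surf_poly_deriv assms(1,4)])
    show "\<And>x. x \<in> D \<Longrightarrow> surf_poly x = (s x)\<^sup>2" using assms by auto
  qed
  ultimately have "surf_poly' w = 0" using DERIV_unique by blast
  moreover have "surf_poly w = 0" using assms s0 by force
  ultimately show False using surf_poly_simple by blast
qed

lemma y_section:
  assumes "open D" "h holomorphic_on D" "\<forall>y\<in>D. y\<^sup>2 = surf_poly (h y)" "y \<in> D"
  shows "surf_poly' (h y) * deriv h y = 2 * y" "surf_poly' (h y) \<noteq> 0"
proof -
  have dh: "(h has_field_derivative deriv h y) (at y)"
    using assms by (auto intro: holomorphic_derivI)
  have "((\<lambda>t. surf_poly (h t)) has_field_derivative surf_poly' (h y) * deriv h y) (at y)"
    by (rule DERIV_chain2[OF surf_poly_deriv dh])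
  moreover have "((\<lambda>t. surf_poly (h t)) has_field_derivative 2 * y) (at y)"
  proof (rule has_field_derivative_transform_within_open[OF _ assms(1,4)])
    show "((\<lambda>t. t\<^sup>2) has_field_derivative 2 * y) (at y)" by (auto intro!: derivative_eq_intros)
    show "\<And>x. x \<in> D \<Longrightarrow> x\<^sup>2 = surf_poly (h x)" using assms by auto
  qed
  ultimately show 1: "surf_poly' (h y) * deriv h y = 2 * y" using DERIV_unique by blast
  show "surf_poly' (h y) \<noteq> 0"
  proof
    assume "surf_poly' (h y) = 0"
    moreover from this 1 have "y = 0" by simp
    moreover from this have "surf_poly (h y) = 0" using assms by force
    ultimately show False using surf_poly_simple by blast
  qed
qed

lemma ev_isCont: "isCont f z \<Longrightarrow> open S \<Longrightarrow> f z \<in> S \<Longrightarrow> \<forall>\<^sub>F t in nhds z. f t \<in> S"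
  by (metis (no_types, lifting) ext isCont_def topological_tendstoD tendsto_at_iff_tendsto_nhds)

lemma ev_sqrt:
  fixes a b :: "complex \<Rightarrow> complex"
  assumes "a analytic_on {z}" "b analytic_on {z}" "\<forall>\<^sub>F t in nhds z. (a t)\<^sup>2 = (b t)\<^sup>2" "a z = b z" "b z \<noteq> 0"
  shows "\<forall>\<^sub>F t in nhds z. a t = b t"
proof -
  have "\<forall>\<^sub>F t in nhds z. a t + b t \<noteq> 0"
    by (rule ev_ne) (use assms in \<open>auto intro!: analytic_intros\<close>)
  with assms(3) show ?thesis
    by eventually_elim (auto simp: power2_eq_iff)
qed

lemma ev_u_poly:
  "p \<in> outer_pts \<Longrightarrow> (fun_v p)\<^sup>2 = 1 - 14 * fun_u p ^ 4 + fun_u p ^ 8"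
proof (cases p)
  case (Affine w y)
  assume "p \<in> outer_pts"
  then have w: "w \<noteq> 0" and y: "y\<^sup>2 = surf_poly w" using Affine by auto
  have "w ^ 8 = w ^ 4 * w ^ 4" by (simp flip: power_add)
  have sq: "(y / w ^ 4)\<^sup>2 = surf_poly w / w ^ 8"
    by (simp add: power_divide y flip: power_mult)
  from \<open>w ^ 8 = w ^ 4 * w ^ 4\<close> have "surf_poly w / w ^ 8 = 1 - 14 * (1 / w) ^ 4 + (1 / w) ^ 8"
    using w by (simp add: surf_poly_def power_divide field_simps)
  with sq show ?thesis by (simp add: Affine)
qed (auto simp: outer_pts_def)

lemma outer_point_uv: "p \<in> outer_pts \<Longrightarrow> p = point_uv (fun_u p) (fun_v p)"
  by (auto simp: outer_pts_def point_uv_def power_divide)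

lemma affine_eq: "p \<in> affine_pts \<Longrightarrow> p = Affine (fun_w p) (fun_y p)"
  by (auto simp: affine_pts_def)

lemma affine_poly: "p \<in> affine_pts \<Longrightarrow> (fun_y p)\<^sup>2 = surf_poly (fun_w p)"
  by (auto simp: affine_pts_def)

lemma u_section_nz:
  fixes s :: "complex \<Rightarrow> complex"
  assumes D: "open D" "s holomorphic_on D" "\<forall>u\<in>D. (s u)\<^sup>2 = 1 - 14 * u ^ 4 + u ^ 8" "u \<in> D"
  shows "s u \<noteq> 0"
proof -
  have "1 - 14 * u ^ 4 + u ^ 8 = surf_poly u" for u by (simp add: surf_poly_def)
  then show ?thesis using w_section_nz[OF D(1,2) _ D(4)] D(3) by simp
qed

lemma reg_in_chart:
  assumes c: "(V, \<psi>) \<in> surf_atlas" and r: "reg r z" "r z \<in> V"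
  shows "\<forall>\<^sub>F t in nhds z. r t \<in> V" "(\<lambda>t. \<psi> (r t)) analytic_on {z}"
proof -
  have "(\<forall>\<^sub>F t in nhds z. r t \<in> V) \<and> (\<lambda>t. \<psi> (r t)) analytic_on {z}"
    using c
  proof (cases rule: atlas_cases)
    case (w s D)
    have c: "V = (\<lambda>w. Affine w (s w)) ` D" "\<psi> = fun_w" using w by auto
    obtain w0 where w0: "w0 \<in> D" "r z = Affine w0 (s w0)" using r c by auto
    have "areg r z" using r w0 w by (intro reg_areg) auto
    then have an: "(\<lambda>t. fun_w (r t)) analytic_on {z}" "(\<lambda>t. fun_y (r t)) analytic_on {z}"
      and aff: "\<forall>\<^sub>F t in nhds z. r t \<in> affine_pts" by (auto simp: areg_def)
    have evD: "\<forall>\<^sub>F t in nhds z. fun_w (r t) \<in> D"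
      using ev_isCont[OF analytic_at_imp_isCont[OF an(1)] w(2)] w0 by simp
    have sn: "s analytic_on {fun_w (r z)}"
      using w w0 by (auto intro: holomorphic_on_imp_analytic_at)
    have "(\<lambda>t. s (fun_w (r t))) analytic_on {z}"
      using analytic_on_compose[OF an(1), of s] sn by (simp add: o_def)
    moreover have "\<forall>\<^sub>F t in nhds z. (fun_y (r t))\<^sup>2 = (s (fun_w (r t)))\<^sup>2"
      using aff evD by eventually_elim (use w(4) affine_poly in simp)
    moreover have "s w0 \<noteq> 0" using w_section_nz w w0 by blast
    ultimately have "\<forall>\<^sub>F t in nhds z. fun_y (r t) = s (fun_w (r t))"
      using an w0 by (intro ev_sqrt[of "\<lambda>t. fun_y (r t)" z "\<lambda>t. s (fun_w (r t))"]) simp_all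
    with aff evD have "\<forall>\<^sub>F t in nhds z. r t \<in> V"
      by eventually_elim (subst affine_eq, simp_all add: c)
    then show ?thesis using an c by simp
  next
    case (y h D)
    have c: "V = (\<lambda>y. Affine (h y) y) ` D" "\<psi> = fun_y" using y by auto
    obtain y0 where y0: "y0 \<in> D" "r z = Affine (h y0) y0" using r c by auto
    have "areg r z" using r y0 y by (intro reg_areg) auto
    then have an: "(\<lambda>t. fun_w (r t)) analytic_on {z}" "(\<lambda>t. fun_y (r t)) analytic_on {z}"
      and aff: "\<forall>\<^sub>F t in nhds z. r t \<in> affine_pts" by (auto simp: areg_def)
    have evD: "\<forall>\<^sub>F t in nhds z. fun_y (r t) \<in> D"
      using ev_isCont[OF analytic_at_imp_isCont[OF an(2)] y(2)] y0 by simp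
    have "deriv surf_poly (h y0) \<noteq> 0"
      using y_section(2)[OF y(2,3,4) y0(1)] DERIV_imp_deriv[OF surf_poly_deriv] by simp
    then obtain e where e: "e > 0" "inj_on surf_poly (ball (h y0) e)"
      using has_complex_derivative_locally_injective[OF surf_poly_holo, of "h y0" UNIV] by auto
    have ew: "\<forall>\<^sub>F t in nhds z. fun_w (r t) \<in> ball (h y0) e"
      using ev_isCont[OF analytic_at_imp_isCont[OF an(1)], of "ball (h y0) e"] y0 e by simp
    have hn: "h analytic_on {fun_y (r z)}"
      using y y0 by (auto intro: holomorphic_on_imp_analytic_at)
    have "(\<lambda>t. h (fun_y (r t))) analytic_on {z}"
      using analytic_on_compose[OF an(2), of h] hn by (simp add: o_def)
    then have eh: "\<forall>\<^sub>F t in nhds z. h (fun_y (r t)) \<in> ball (h y0) e"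
      using ev_isCont[OF analytic_at_imp_isCont, of "\<lambda>t. h (fun_y (r t))" z "ball (h y0) e"] y0 e by simp
    have "\<forall>\<^sub>F t in nhds z. fun_w (r t) = h (fun_y (r t))"
      using aff evD ew eh
    proof eventually_elim
      case (elim t)
      then have "surf_poly (fun_w (r t)) = surf_poly (h (fun_y (r t)))"
        using bspec[OF y(4) elim(2)] affine_poly[OF elim(1)] by metis
      then show ?case using elim e(2) by (meson inj_onD)
    qed
    with aff evD have "\<forall>\<^sub>F t in nhds z. r t \<in> V"
      by eventually_elim (subst affine_eq, simp_all add: c)
    then show ?thesis using an c by simp
  next
    case (u s D)
    have c: "V = (\<lambda>u. point_uv u (s u)) ` D" "\<psi> = fun_u" using u by auto
    obtain u0 where u0: "u0 \<in> D" "r z = point_uv u0 (s u0)" using r c by auto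
    have "ireg r z" using r u0 u by (intro reg_ireg) (auto intro: point_uv_outer)
    then have an: "(\<lambda>t. fun_u (r t)) analytic_on {z}" "(\<lambda>t. fun_v (r t)) analytic_on {z}"
      and out: "\<forall>\<^sub>F t in nhds z. r t \<in> outer_pts" by (auto simp: ireg_def)
    have evD: "\<forall>\<^sub>F t in nhds z. fun_u (r t) \<in> D"
      using ev_isCont[OF analytic_at_imp_isCont[OF an(1)] u(2)] u0 by simp
    have sn: "s analytic_on {fun_u (r z)}"
      using u u0 by (auto intro: holomorphic_on_imp_analytic_at)
    have "(\<lambda>t. s (fun_u (r t))) analytic_on {z}"
      using analytic_on_compose[OF an(1), of s] sn by (simp add: o_def)
    moreover have "\<forall>\<^sub>F t in nhds z. (fun_v (r t))\<^sup>2 = (s (fun_u (r t)))\<^sup>2"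
      using out evD by eventually_elim (use u(4) ev_u_poly in simp)
    moreover have "s u0 \<noteq> 0" using u_section_nz u u0 by blast
    ultimately have "\<forall>\<^sub>F t in nhds z. fun_v (r t) = s (fun_u (r t))"
      using an u0 by (intro ev_sqrt[of "\<lambda>t. fun_v (r t)" z "\<lambda>t. s (fun_u (r t))"]) simp_all
    with out evD have "\<forall>\<^sub>F t in nhds z. r t \<in> V"
      by eventually_elim (subst outer_point_uv, simp_all add: c)
    then show ?thesis using an c by simp
  qed
  then show "\<forall>\<^sub>F t in nhds z. r t \<in> V" "(\<lambda>t. \<psi> (r t)) analytic_on {z}" by auto
qed

subsection \<open>The surface is a Riemann surface\<close>

lemma sqrt_section:
  assumes holo: "f holomorphic_on UNIV" and nz: "b \<noteq> 0" and eq: "b\<^sup>2 = f a"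
  obtains s e where "e > 0" "s holomorphic_on ball a e" "s a = b"
    "\<And>t. t \<in> ball a e \<Longrightarrow> (s t)\<^sup>2 = f t" "\<And>t. t \<in> ball a e \<Longrightarrow> f t \<noteq> (0::complex)"
proof -
  have "f analytic_on {a}" using holo by (auto simp: analytic_at)
  moreover have "f a \<noteq> 0" using nz eq by (metis power_not_zero)
  ultimately have "\<forall>\<^sub>F t in nhds a. f t \<noteq> 0" by (rule ev_ne)
  then obtain e where e: "e > 0" "\<And>t. t \<in> ball a e \<Longrightarrow> f t \<noteq> 0"
    by (auto simp: eventually_nhds_metric dist_commute)
  obtain g where g: "g holomorphic_on ball a e" "\<And>t. t \<in> ball a e \<Longrightarrow> f t = g t ^ 2"
    using contractible_imp_holomorphic_sqrt[of f "ball a e"] e holo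
    by (metis convex_ball convex_imp_contractible holomorphic_on_subset subset_UNIV)
  have "(g a)\<^sup>2 = b\<^sup>2" using g(2)[of a] e eq by simp
  then have "g a = b \<or> g a = - b" by (simp add: power2_eq_iff)
  then show thesis
  proof
    assume "g a = b"
    then show thesis using that[of e g] e g by metis
  next
    assume "g a = - b"
    then show thesis using that[of e "\<lambda>t. - g t"] e g by (auto intro!: holomorphic_intros)
  qed
qed

lemma branch_section:
  assumes "surf_poly w0 = 0"
  obtains h e where "e > 0" "h holomorphic_on ball 0 e" "h 0 = w0"
    "\<And>y. y \<in> ball 0 e \<Longrightarrow> y\<^sup>2 = surf_poly (h y)" "\<And>y. h (- y) = h y"
proof -
  have "deriv surf_poly w0 \<noteq> 0"
    using surf_poly_simple[OF assms] DERIV_imp_deriv[OF surf_poly_deriv] by simp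
  then obtain r where r: "r > 0" "open (surf_poly ` ball w0 r)" "inj_on surf_poly (ball w0 r)"
    using has_complex_derivative_locally_invertible[OF surf_poly_holo, of w0 UNIV] by auto
  obtain g where g: "g holomorphic_on surf_poly ` ball w0 r" "\<And>z. z \<in> ball w0 r \<Longrightarrow> g (surf_poly z) = z"
    using holomorphic_has_inverse[OF surf_poly_holo open_ball r(3)] by metis
  let ?D = "(\<lambda>y. y\<^sup>2) -` (surf_poly ` ball w0 r)"
  have "open ?D" using r(2) by (intro open_vimage) (auto intro!: continuous_intros)
  moreover have "0 \<in> ?D" using assms r(1) by (force simp: image_iff)
  ultimately obtain e where e: "e > 0" "ball 0 e \<subseteq> ?D" by (meson openE)
  show thesis
  proof (rule that[of e "\<lambda>y. g (y\<^sup>2)"])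
    show "(\<lambda>y. g (y\<^sup>2)) holomorphic_on ball 0 e"
    proof -
      have "(\<lambda>y::complex. y\<^sup>2) holomorphic_on ball 0 e" by (intro holomorphic_intros)
      moreover have "(\<lambda>y. y\<^sup>2) ` ball 0 e \<subseteq> surf_poly ` ball w0 r" using e by blast
      ultimately show ?thesis using holomorphic_on_compose_gen[OF _ g(1)] by (fastforce simp: o_def)
    qed
    show "g (0\<^sup>2) = w0" using g(2)[of w0] assms r(1) by simp
    show "y\<^sup>2 = surf_poly (g (y\<^sup>2))" if y: "y \<in> ball 0 e" for y
    proof -
      obtain z where "z \<in> ball w0 r" "y\<^sup>2 = surf_poly z" using y e by blast
      then show ?thesis using g(2) by metis
    qed
  qed (use e in auto)
qed

lemma w_chartI:
  "open D \<Longrightarrow> s holomorphic_on D \<Longrightarrow> \<forall>w\<in>D. (s w)\<^sup>2 = surf_poly w \<Longrightarrow>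
     ((\<lambda>w. Affine w (s w)) ` D, fun_w) \<in> surf_atlas"
  unfolding surf_atlas_def Un_iff mem_Collect_eq
  by (rule disjI1, rule disjI1, intro exI conjI, rule refl)

lemma y_chartI:
  "open D \<Longrightarrow> h holomorphic_on D \<Longrightarrow> \<forall>y\<in>D. y\<^sup>2 = surf_poly (h y) \<Longrightarrow>
     ((\<lambda>y. Affine (h y) y) ` D, fun_y) \<in> surf_atlas"
  unfolding surf_atlas_def Un_iff mem_Collect_eq
  by (rule disjI1, rule disjI2, intro exI conjI, rule refl)

lemma u_chartI:
  "open D \<Longrightarrow> s holomorphic_on D \<Longrightarrow> \<forall>u\<in>D. (s u)\<^sup>2 = 1 - 14 * u ^ 4 + u ^ 8 \<Longrightarrow>
     ((\<lambda>u. point_uv u (s u)) ` D, fun_u) \<in> surf_atlas"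
  unfolding surf_atlas_def Un_iff mem_Collect_eq
  by (rule disjI2, intro exI conjI, rule refl)

lemma chart_exists:
  assumes "p \<in> surf"
  obtains U \<phi> where "(U, \<phi>) \<in> surf_atlas" "p \<in> U"
proof (cases p)
  case (Affine w y)
  then have eq: "y\<^sup>2 = surf_poly w" using assms by simp
  show thesis
  proof (cases "y = 0")
    case False
    obtain s e where "e > 0" "s holomorphic_on ball w e" "s w = y" "\<And>t. t \<in> ball w e \<Longrightarrow> (s t)\<^sup>2 = surf_poly t"
      using sqrt_section[OF surf_poly_holo False eq] by metis
    then show thesis
      using that[OF w_chartI[of "ball w e" s]] Affine by force
  next
    case True
    then have "surf_poly w = 0" using eq by simp
    then obtain h e where "e > 0" "h holomorphic_on ball 0 e" "h 0 = w"
        "\<And>y. y \<in> ball 0 e \<Longrightarrow> y\<^sup>2 = surf_poly (h y)"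
      using branch_section by metis
    then show thesis
      using that[OF y_chartI[of "ball 0 e" h]] Affine True by force
  qed
next
  case (At_inf v)
  then have eq: "v\<^sup>2 = 1 - 14 * 0 ^ 4 + (0::complex) ^ 8" "v \<noteq> 0" using assms by auto
  have "(\<lambda>u. 1 - 14 * u ^ 4 + u ^ 8 :: complex) holomorphic_on UNIV" by (intro holomorphic_intros)
  then obtain s e where "e > 0" "s holomorphic_on ball 0 e" "s 0 = v"
       "\<And>u. u \<in> ball 0 e \<Longrightarrow> (s u)\<^sup>2 = 1 - 14 * u ^ 4 + u ^ 8"
    using sqrt_section[of "\<lambda>u. 1 - 14 * u ^ 4 + u ^ 8", OF _ eq(2,1)] by metis
  then show thesis
    using that[OF u_chartI[of "ball 0 e" s]] At_inf by (force simp: point_uv_def)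
qed

lemma chart_subset:
  assumes "(U, \<phi>) \<in> surf_atlas"
  shows "U \<subseteq> surf"
proof
  fix p assume p: "p \<in> U"
  then have "reg (inv_into U \<phi>) (\<phi> p)" using chart_reg[OF assms] by blast
  then have "inv_into U \<phi> (\<phi> p) \<in> surf" using reg_surf ev_at by blast
  then show "p \<in> surf" using chart_inj_open[OF assms] p by simp
qed

lemma surf_cover: "\<Union> (fst ` surf_atlas) = surf"
proof
  show "\<Union> (fst ` surf_atlas) \<subseteq> surf" using chart_subset by fastforce
  show "surf \<subseteq> \<Union> (fst ` surf_atlas)"
  proof
    fix p assume "p \<in> surf"
    then obtain U \<phi> where "(U, \<phi>) \<in> surf_atlas" "p \<in> U" using chart_exists by blast
    then show "p \<in> \<Union> (fst ` surf_atlas)" by force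
  qed
qed

lemma open_evI:
  assumes "\<And>z. z \<in> S \<Longrightarrow> \<forall>\<^sub>F t in nhds z. t \<in> S"
  shows "open S"
proof (subst open_subopen, intro ballI)
  fix z assume "z \<in> S"
  then obtain T where "open T" "z \<in> T" "\<forall>t\<in>T. t \<in> S" using assms unfolding eventually_nhds by meson
  then show "\<exists>T. open T \<and> z \<in> T \<and> T \<subseteq> S" by blast
qed

lemma ev_chart:
  assumes "(U, \<phi>) \<in> surf_atlas" "z \<in> \<phi> ` U"
  shows "\<forall>\<^sub>F t in nhds z. t \<in> \<phi> ` U"
  using chart_inj_open[OF assms(1)] assms(2) by (simp add: eventually_nhds_in_open)

lemma chart_image:
  assumes "(U, \<phi>) \<in> surf_atlas"
  shows "\<phi> ` (U \<inter> S) = {t \<in> \<phi> ` U. inv_into U \<phi> t \<in> S}"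
  using chart_inj_open[OF assms] by force

lemma chart_open_evI:
  assumes c: "(U, \<phi>) \<in> surf_atlas"
    and ev: "\<And>z. z \<in> \<phi> ` U \<Longrightarrow> inv_into U \<phi> z \<in> S \<Longrightarrow> \<forall>\<^sub>F t in nhds z. inv_into U \<phi> t \<in> S"
  shows "open (\<phi> ` (U \<inter> S))"
proof (rule open_evI)
  fix z assume "z \<in> \<phi> ` (U \<inter> S)"
  then have z: "z \<in> \<phi> ` U" "inv_into U \<phi> z \<in> S" by (auto simp: chart_image[OF c])
  show "\<forall>\<^sub>F t in nhds z. t \<in> \<phi> ` (U \<inter> S)"
    using ev_chart[OF c z(1)] ev[OF z] by eventually_elim (simp add: chart_image[OF c])
qed

lemma holomorphic_evI:
  fixes f :: "complex \<Rightarrow> complex"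
  shows "(\<And>z. z \<in> S \<Longrightarrow> f analytic_on {z}) \<Longrightarrow> f holomorphic_on S"
  using analytic_on_analytic_at analytic_imp_holomorphic by blast

lemma surf_complex_atlas: "complex_atlas surf surf_atlas"
proof -
  have "open (\<phi> ` (U \<inter> V)) \<and> (\<psi> \<circ> inv_into U \<phi>) holomorphic_on \<phi> ` (U \<inter> V)"
    if c: "(U, \<phi>) \<in> surf_atlas" "(V, \<psi>) \<in> surf_atlas" for U \<phi> V \<psi>
  proof
    show "open (\<phi> ` (U \<inter> V))"
      by (rule chart_open_evI[OF c(1)]) (rule reg_in_chart(1)[OF c(2) chart_reg[OF c(1)]])
    show "(\<psi> \<circ> inv_into U \<phi>) holomorphic_on \<phi> ` (U \<inter> V)"
    proof (rule holomorphic_evI)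
      fix z assume "z \<in> \<phi> ` (U \<inter> V)"
      then have "z \<in> \<phi> ` U" "inv_into U \<phi> z \<in> V" by (auto simp: chart_image[OF c(1)])
      then show "(\<psi> \<circ> inv_into U \<phi>) analytic_on {z}"
        using reg_in_chart(2)[OF c(2) chart_reg[OF c(1)]] by (simp add: o_def)
    qed
  qed
  then show ?thesis
    unfolding complex_atlas_def using surf_cover chart_inj_open by fast
qed

lemma istopology_atlas:
  assumes "complex_atlas X A"
  shows "istopology (\<lambda>S. S \<subseteq> \<Union> (fst ` A) \<and> (\<forall>(U, \<phi>) \<in> A. open (\<phi> ` (S \<inter> U))))"
proof -
  have "open (\<phi> ` (S \<inter> T \<inter> U))"
    if "(U, \<phi>) \<in> A" "open (\<phi> ` (S \<inter> U))" "open (\<phi> ` (T \<inter> U))" for U \<phi> S T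
  proof -
    have "inj_on \<phi> U" using assms that(1) unfolding complex_atlas_def by blast
    then have "\<phi> ` (S \<inter> T \<inter> U) = \<phi> ` (S \<inter> U) \<inter> \<phi> ` (T \<inter> U)"
      by (auto simp: inj_on_def)
    then show ?thesis using that by auto
  qed
  moreover have "open (\<phi> ` (\<Union> K \<inter> U))"
    if "\<forall>S\<in>K. open (\<phi> ` (S \<inter> U))" for K U and \<phi> :: "'a \<Rightarrow> complex"
  proof -
    have "\<phi> ` (\<Union> K \<inter> U) = (\<Union>S\<in>K. \<phi> ` (S \<inter> U))" by blast
    then show ?thesis using that by auto
  qed
  ultimately show ?thesis
    unfolding istopology_def by (auto simp: split_beta)
qed

lemma openin_atlas:
  "openin (atlas_topology surf_atlas) S \<longleftrightarrow>
     S \<subseteq> surf \<and> (\<forall>(U, \<phi>) \<in> surf_atlas. open (\<phi> ` (S \<inter> U)))"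
  unfolding atlas_topology_def
  by (subst topology_inverse'[OF istopology_atlas[OF surf_complex_atlas]]) (simp add: surf_cover)

lemma openin_atlasI:
  assumes "S \<subseteq> surf" "\<And>r z. reg r z \<Longrightarrow> r z \<in> S \<Longrightarrow> \<forall>\<^sub>F t in nhds z. r t \<in> S"
  shows "openin (atlas_topology surf_atlas) S"
proof -
  have "open (\<phi> ` (S \<inter> U))" if c: "(U, \<phi>) \<in> surf_atlas" for U \<phi>
    using chart_open_evI[OF c, of S] assms(2) chart_reg[OF c] by (simp add: Int_commute)
  then show ?thesis using assms(1) by (auto simp: openin_atlas)
qed

lemma openin_atlasD:
  assumes S: "openin (atlas_topology surf_atlas) S" and r: "reg r z" "r z \<in> S"
  shows "\<forall>\<^sub>F t in nhds z. r t \<in> S"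
proof -
  have "r z \<in> surf" using r S openin_atlas by blast
  then obtain V \<psi> where c: "(V, \<psi>) \<in> surf_atlas" "r z \<in> V" by (rule chart_exists)
  have op: "open (\<psi> ` (S \<inter> V))" using S c openin_atlas by blast
  have "\<forall>\<^sub>F t in nhds z. \<psi> (r t) \<in> \<psi> ` (S \<inter> V)"
    using ev_isCont[OF analytic_at_imp_isCont[OF reg_in_chart(2)[OF c(1) r(1) c(2)]] op] r c by simp
  with reg_in_chart(1)[OF c(1) r(1) c(2)] show ?thesis
  proof eventually_elim
    case (elim t)
    then obtain q where "q \<in> S" "q \<in> V" "\<psi> (r t) = \<psi> q" by blast
    then show ?case using inj_onD[OF chart_inj_open(1)[OF c(1)]] elim(1) by metis
  qed
qed

lemma topspace_atlas: "topspace (atlas_topology surf_atlas) = surf"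
proof
  show "topspace (atlas_topology surf_atlas) \<subseteq> surf"
    using openin_topspace[of "atlas_topology surf_atlas"] openin_atlas by blast
  have "openin (atlas_topology surf_atlas) surf"
    by (rule openin_atlasI) (auto intro: reg_surf)
  then show "surf \<subseteq> topspace (atlas_topology surf_atlas)" by (rule openin_subset)
qed

lemma ev_analytic_in:
  fixes f :: "complex \<Rightarrow> complex"
  shows "f analytic_on {z} \<Longrightarrow> open B \<Longrightarrow> f z \<in> B \<Longrightarrow> \<forall>\<^sub>F t in nhds z. f t \<in> B"
  using ev_isCont analytic_at_imp_isCont by blast

lemma open_coord:
  assumes "open B"
  shows "openin (atlas_topology surf_atlas) {p \<in> affine_pts. fun_w p \<in> B}"
    "openin (atlas_topology surf_atlas) {p \<in> affine_pts. fun_y p \<in> B}"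
    "openin (atlas_topology surf_atlas) {p \<in> outer_pts. fun_u p \<in> B}"
    "openin (atlas_topology surf_atlas) {p \<in> outer_pts. fun_v p \<in> B}"
proof -
  have a: "openin (atlas_topology surf_atlas) {p \<in> affine_pts. f p \<in> B}"
    if "\<And>r z. areg r z \<Longrightarrow> (\<lambda>t. f (r t)) analytic_on {z}" for f
  proof (rule openin_atlasI)
    fix r z assume r: "reg r z" "r z \<in> {p \<in> affine_pts. f p \<in> B}"
    then have a: "areg r z" using reg_areg by simp
    then have "\<forall>\<^sub>F t in nhds z. r t \<in> affine_pts" by (simp add: areg_def)
    moreover have "\<forall>\<^sub>F t in nhds z. f (r t) \<in> B"
      using ev_analytic_in[OF that[OF a] assms] r by simp
    ultimately show "\<forall>\<^sub>F t in nhds z. r t \<in> {p \<in> affine_pts. f p \<in> B}" by eventually_elim simp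
  qed (auto simp: surf_eq)
  have b: "openin (atlas_topology surf_atlas) {p \<in> outer_pts. f p \<in> B}"
    if "\<And>r z. ireg r z \<Longrightarrow> (\<lambda>t. f (r t)) analytic_on {z}" for f
  proof (rule openin_atlasI)
    fix r z assume r: "reg r z" "r z \<in> {p \<in> outer_pts. f p \<in> B}"
    then have a: "ireg r z" using reg_ireg by simp
    then have "\<forall>\<^sub>F t in nhds z. r t \<in> outer_pts" by (simp add: ireg_def)
    moreover have "\<forall>\<^sub>F t in nhds z. f (r t) \<in> B"
      using ev_analytic_in[OF that[OF a] assms] r by simp
    ultimately show "\<forall>\<^sub>F t in nhds z. r t \<in> {p \<in> outer_pts. f p \<in> B}" by eventually_elim simp
  qed (auto simp: surf_eq)
  show "openin (atlas_topology surf_atlas) {p \<in> affine_pts. fun_w p \<in> B}"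
    "openin (atlas_topology surf_atlas) {p \<in> affine_pts. fun_y p \<in> B}"
    by (rule a, simp add: areg_def)+
  show "openin (atlas_topology surf_atlas) {p \<in> outer_pts. fun_u p \<in> B}"
    "openin (atlas_topology surf_atlas) {p \<in> outer_pts. fun_v p \<in> B}"
    by (rule b, simp add: ireg_def)+
qed

lemma surf_Hausdorff: "Hausdorff_space (atlas_topology surf_atlas)"
proof -
  let ?T = "atlas_topology surf_atlas"
  have sep: "\<exists>S T. openin ?T S \<and> openin ?T T \<and> p \<in> S \<and> q \<in> T \<and> disjnt S T"
    if "\<And>B. open B \<Longrightarrow> openin ?T {p \<in> E. f p \<in> B}" "p \<in> E" "q \<in> E" and ne: "f p \<noteq> f q"
    for f :: "surf_point \<Rightarrow> complex" and E p q
  proof -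
    obtain B C where "open B" "open C" "f p \<in> B" "f q \<in> C" "B \<inter> C = {}"
      using hausdorff[OF ne] by blast
    then show ?thesis
      using that
      by (intro exI[of _ "{p \<in> E. f p \<in> B}"] exI[of _ "{p \<in> E. f p \<in> C}"]) (auto simp: disjnt_def)
  qed
  have mixed: "\<exists>S T. openin ?T S \<and> openin ?T T \<and> p \<in> S \<and> q \<in> T \<and> disjnt S T"
    if "p \<in> affine_pts" "p \<notin> outer_pts" "q \<in> outer_pts" "q \<notin> affine_pts" for p q
  proof (intro exI conjI)
    show "openin ?T {p \<in> affine_pts. fun_w p \<in> ball 0 1}" "openin ?T {p \<in> outer_pts. fun_u p \<in> ball 0 1}"
      by (intro open_coord open_ball)+
    show "p \<in> {p \<in> affine_pts. fun_w p \<in> ball 0 1}" using that by (auto simp: affine_pts_def)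
    show "q \<in> {p \<in> outer_pts. fun_u p \<in> ball 0 1}" using that by (auto simp: outer_pts_def)
    show "disjnt {p \<in> affine_pts. fun_w p \<in> ball 0 1} {p \<in> outer_pts. fun_u p \<in> ball 0 1}"
      by (auto simp: disjnt_def affine_pts_def norm_divide divide_simps split: if_splits)
  qed
  have "\<exists>S T. openin ?T S \<and> openin ?T T \<and> p \<in> S \<and> q \<in> T \<and> disjnt S T"
    if pq: "p \<in> surf" "q \<in> surf" "p \<noteq> q" for p q
  proof -
    consider "p \<in> affine_pts" "q \<in> affine_pts" | "p \<in> outer_pts" "q \<in> outer_pts"
      | "p \<in> affine_pts" "p \<notin> outer_pts" "q \<in> outer_pts" "q \<notin> affine_pts"
      | "q \<in> affine_pts" "q \<notin> outer_pts" "p \<in> outer_pts" "p \<notin> affine_pts"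
      using pq surf_eq by blast
    then show ?thesis
    proof cases
      case 1
      then have "fun_w p \<noteq> fun_w q \<or> fun_y p \<noteq> fun_y q" using pq(3) affine_eq by metis
      then show ?thesis using sep[OF open_coord(1) 1] sep[OF open_coord(2) 1] by blast
    next
      case 2
      then have "fun_u p \<noteq> fun_u q \<or> fun_v p \<noteq> fun_v q" using pq(3) outer_point_uv by metis
      then show ?thesis using sep[OF open_coord(3) 2] sep[OF open_coord(4) 2] by blast
    next
      case 3
      then show ?thesis by (rule mixed)
    next
      case 4
      then show ?thesis using mixed[OF 4] disjnt_sym by blast
    qed
  qed
  then show ?thesis unfolding Hausdorff_space_def topspace_atlas by blast
qed

text \<open>Points where \<open>\<omega>\<close> is a local coordinate.\<close>

definition good :: "surf_point \<Rightarrow> bool" where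
  "good p \<longleftrightarrow> p \<in> affine_pts \<and> fun_y p \<noteq> 0"

lemma ev_at_ident: "\<forall>\<^sub>F t in at z. t \<noteq> (c::complex)"
  by (rule eventually_neq_at_within)

lemma ev_at_nhds: "\<forall>\<^sub>F t in nhds z. P t \<Longrightarrow> \<forall>\<^sub>F t in at z. P t"
  by (auto simp: eventually_at_filter elim: eventually_mono)

lemma chart_good:
  assumes c: "(U, \<phi>) \<in> surf_atlas" "z \<in> \<phi> ` U"
  shows "\<forall>\<^sub>F t in at z. good (inv_into U \<phi> t)"
  using c(1)
proof (cases rule: atlas_cases)
  case (w s D)
  have e: "U = (\<lambda>w. Affine w (s w)) ` D" "\<phi> = fun_w" using w by auto
  show ?thesis using ev_at_nhds[OF ev_chart[OF c]]
    by eventually_elim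
      (use w w_section_nz[OF w(2-4)] in \<open>auto simp: good_def section_props(3)[of D fun_w "\<lambda>w. Affine w (s w)"]\<close>)
next
  case (y h D)
  have e: "U = (\<lambda>y. Affine (h y) y) ` D" "\<phi> = fun_y" using y by auto
  show ?thesis using ev_at_nhds[OF ev_chart[OF c]] ev_at_ident[of 0 z]
    by eventually_elim
      (use y in \<open>auto simp: good_def section_props(3)[of D fun_y "\<lambda>y. Affine (h y) y"]\<close>)
next
  case (u s D)
  have e: "U = (\<lambda>u. point_uv u (s u)) ` D" "\<phi> = fun_u" using u by auto
  show ?thesis using ev_at_nhds[OF ev_chart[OF c]] ev_at_ident[of 0 z]
  proof eventually_elim
    case (elim t)
    then have "t \<in> D" by (auto simp: e)
    then have "inv_into U \<phi> t = point_uv t (s t)"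
      by (simp add: e section_props(3)[of D fun_u "\<lambda>u. point_uv u (s u)"])
    moreover have "point_uv t (s t) \<in> outer_pts" using \<open>t \<in> D\<close> u(4) by (intro point_uv_outer) auto
    moreover have "s t \<noteq> 0" using u_section_nz[OF u(2-4) \<open>t \<in> D\<close>] .
    ultimately show ?case using elim by (auto simp: good_def point_uv_def)
  qed
qed

lemma open_has_good:
  assumes S: "openin (atlas_topology surf_atlas) S" "p \<in> S"
  obtains q where "q \<in> S" "good q"
proof -
  have "p \<in> surf" using S openin_atlas by blast
  then obtain U \<phi> where c: "(U, \<phi>) \<in> surf_atlas" "p \<in> U" by (rule chart_exists)
  then have z: "\<phi> p \<in> \<phi> ` U" "inv_into U \<phi> (\<phi> p) = p" using chart_inj_open by auto
  have "\<forall>\<^sub>F t in at (\<phi> p). inv_into U \<phi> t \<in> S"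
    using openin_atlasD[OF S(1) chart_reg[OF c(1) z(1)]] z S(2) ev_at_nhds by simp
  with chart_good[OF c(1) z(1)] have "\<forall>\<^sub>F t in at (\<phi> p). inv_into U \<phi> t \<in> S \<and> good (inv_into U \<phi> t)"
    by eventually_elim simp
  then have "\<exists>t. inv_into U \<phi> t \<in> S \<and> good (inv_into U \<phi> t)"
    using eventually_happens[of _ "at (\<phi> p)"] by auto
  then show thesis using that by blast
qed

lemma surf_poly_has_root: "\<exists>w. surf_poly w = 0"
proof
  define r where "r = csqrt (csqrt (7 + 4 * csqrt 3))"
  have 1: "r ^ 4 = 7 + 4 * csqrt 3"
  proof -
    have "r ^ 4 = ((r\<^sup>2)\<^sup>2)" by (simp flip: power_mult)
    then show ?thesis unfolding r_def power2_csqrt .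
  qed
  have "csqrt 3 * csqrt 3 = 3" by (metis power2_csqrt power2_eq_square)
  moreover have "surf_poly r = r ^ 4 * r ^ 4 - 14 * r ^ 4 + 1"
    by (simp add: surf_poly_def flip: power_add)
  ultimately show "surf_poly r = 0" by (simp add: 1 algebra_simps)
qed

lemma finite_roots: "finite {w. surf_poly w = 0}"
proof -
  define p :: "complex poly" where "p = monom 1 8 - monom 14 4 + 1"
  have "poly p w = surf_poly w" for w by (simp add: p_def poly_monom surf_poly_def)
  moreover have "p \<noteq> 0"
  proof
    assume "p = 0"
    then have "poly p 0 = 0" by simp
    then show False by (simp add: p_def poly_monom)
  qed
  ultimately show ?thesis using poly_roots_finite[of p] by simp
qed

lemma lift_stays:
  assumes S: "openin (atlas_topology surf_atlas) S" and y: "y\<^sup>2 = surf_poly w" "y \<noteq> 0"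
  obtains s where "s w = y" "\<forall>\<^sub>F t in nhds w. (s t)\<^sup>2 = surf_poly t"
    "Affine w y \<in> S \<longrightarrow> (\<forall>\<^sub>F t in nhds w. Affine t (s t) \<in> S)"
    "Affine w (- y) \<in> S \<longrightarrow> (\<forall>\<^sub>F t in nhds w. Affine t (- s t) \<in> S)"
proof -
  obtain s e where s: "e > 0" "s holomorphic_on ball w e" "s w = y" "\<And>t. t \<in> ball w e \<Longrightarrow> (s t)\<^sup>2 = surf_poly t"
    using sqrt_section[OF surf_poly_holo y(2,1)] by metis
  have ev: "\<forall>\<^sub>F t in nhds w. t \<in> ball w e" using s(1) by (intro eventually_nhds_in_open) auto
  have ev2: "\<forall>\<^sub>F t in nhds w. (s t)\<^sup>2 = surf_poly t" using ev by eventually_elim (use s in auto)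
  have an: "s analytic_on {w}" using s by (auto intro: holomorphic_on_imp_analytic_at)
  have reg: "reg (\<lambda>t. Affine t (s t)) w" "reg (\<lambda>t. Affine t (- s t)) w"
    unfolding reg_def areg_def using ev2 an by (auto intro!: analytic_intros)
  show thesis
    by (rule that[of s, OF s(3) ev2])
      (use openin_atlasD[OF S reg(1)] openin_atlasD[OF S reg(2)] s(3) in auto)
qed

lemma surf_connected: "connected_space (atlas_topology surf_atlas)"
proof -
  let ?X = "atlas_topology surf_atlas"
  have False if T: "openin ?X T" "openin ?X T'" "T \<union> T' = surf" "T \<inter> T' = {}" "T \<noteq> {}" "T' \<noteq> {}" for T T'
  proof -
    define W where "W = {w. surf_poly w \<noteq> 0}"
    define E where "E S = {w \<in> W. \<forall>y. y\<^sup>2 = surf_poly w \<longrightarrow> Affine w y \<in> S}" for S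
    define N where "N = {w \<in> W. \<exists>y y'. y\<^sup>2 = surf_poly w \<and> y'\<^sup>2 = surf_poly w \<and> Affine w y \<in> T \<and> Affine w y' \<in> T'}"
    have W: "open W"
      using finite_imp_closed[OF finite_roots] unfolding W_def
      by (simp add: closed_def Compl_eq)
    have "W = UNIV - {w. surf_poly w = 0}" by (auto simp: W_def)
    then have conW: "connected W"
      using connected_open_delete_finite[OF open_UNIV connected_UNIV _ finite_roots] by simp
    have evW: "\<forall>\<^sub>F t in nhds w. t \<in> W" if "w \<in> W" for w
      using W that by (simp add: eventually_nhds_in_open)
    have openE: "open (E S)" if S: "openin ?X S" for S
    proof (rule open_evI)
      fix w assume w: "w \<in> E S"
      define y where "y = csqrt (surf_poly w)"
      have y: "y\<^sup>2 = surf_poly w" "y \<noteq> 0" using w by (auto simp: y_def E_def W_def)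
      obtain s where s: "s w = y" "\<forall>\<^sub>F t in nhds w. (s t)\<^sup>2 = surf_poly t"
          "Affine w y \<in> S \<longrightarrow> (\<forall>\<^sub>F t in nhds w. Affine t (s t) \<in> S)"
          "Affine w (- y) \<in> S \<longrightarrow> (\<forall>\<^sub>F t in nhds w. Affine t (- s t) \<in> S)"
        by (rule lift_stays[OF S y])
      have "Affine w y \<in> S" "Affine w (- y) \<in> S" using w y by (auto simp: E_def)
      moreover have "w \<in> W" using w by (simp add: E_def)
      ultimately show "\<forall>\<^sub>F t in nhds w. t \<in> E S"
        using evW[of w] s(2) s(3) s(4)
      proof -
        assume a: "Affine w y \<in> S" "Affine w (- y) \<in> S" "w \<in> W"
        show ?thesis
          using evW[OF a(3)] s(2) s(3)[rule_format, OF a(1)] s(4)[rule_format, OF a(2)]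
        proof eventually_elim
          case (elim t)
          have "Affine t y' \<in> S" if "y'\<^sup>2 = surf_poly t" for y'
          proof -
            have "y'\<^sup>2 = (s t)\<^sup>2" using that elim(2) by simp
            then have "y' = s t \<or> y' = - s t" by (simp add: power2_eq_iff)
            then show ?thesis using elim by auto
          qed
          then show ?case using elim(1) by (simp add: E_def)
        qed
      qed
    qed
    have openN: "open N"
    proof (rule open_evI)
      fix w assume w: "w \<in> N"
      then obtain y y' where y: "y\<^sup>2 = surf_poly w" "y'\<^sup>2 = surf_poly w" "Affine w y \<in> T" "Affine w y' \<in> T'"
        and wW: "w \<in> W" by (auto simp: N_def)
      have nz: "y \<noteq> 0" "y' \<noteq> 0" using y wW by (auto simp: W_def)
      obtain s where s: "s w = y" "\<forall>\<^sub>F t in nhds w. (s t)\<^sup>2 = surf_poly t"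
          "Affine w y \<in> T \<longrightarrow> (\<forall>\<^sub>F t in nhds w. Affine t (s t) \<in> T)"
          "Affine w (- y) \<in> T \<longrightarrow> (\<forall>\<^sub>F t in nhds w. Affine t (- s t) \<in> T)"
        by (rule lift_stays[OF T(1) y(1) nz(1)])
      obtain s' where s': "s' w = y'" "\<forall>\<^sub>F t in nhds w. (s' t)\<^sup>2 = surf_poly t"
          "Affine w y' \<in> T' \<longrightarrow> (\<forall>\<^sub>F t in nhds w. Affine t (s' t) \<in> T')"
          "Affine w (- y') \<in> T' \<longrightarrow> (\<forall>\<^sub>F t in nhds w. Affine t (- s' t) \<in> T')"
        by (rule lift_stays[OF T(2) y(2) nz(2)])
      show "\<forall>\<^sub>F t in nhds w. t \<in> N"
        using evW[OF wW] s(2) s(3)[rule_format, OF y(3)] s'(2) s'(3)[rule_format, OF y(4)] by eventually_elim (auto simp: N_def)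
    qed
    have cover: "W \<subseteq> (E T \<union> E T') \<union> N"
    proof
      fix w assume w: "w \<in> W"
      have "Affine w y \<in> T \<or> Affine w y \<in> T'" if "y\<^sup>2 = surf_poly w" for y
        using T(3) that by (metis Un_iff surf_iff(1))
      then show "w \<in> (E T \<union> E T') \<union> N" using w unfolding E_def N_def by blast
    qed
    have lift: "\<exists>y. y\<^sup>2 = surf_poly w" for w by (metis power2_csqrt)
    have dis1: "(E T \<union> E T') \<inter> N = {}" using T(4) unfolding E_def N_def by blast
    have dis2: "E T \<inter> E T' = {}" using T(4) lift unfolding E_def by blast
    obtain w0 where w0: "surf_poly w0 = 0" using surf_poly_has_root by blast
    obtain h e where h: "e > 0" "h holomorphic_on ball 0 e" "h 0 = w0"
        "\<And>y. y \<in> ball 0 e \<Longrightarrow> y\<^sup>2 = surf_poly (h y)" "\<And>y. h (- y) = h y"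
      using branch_section[OF w0] by metis
    have near: "E S \<noteq> {}" if S: "openin ?X S" "Affine w0 0 \<in> S" for S
    proof -
      let ?r = "\<lambda>y. Affine (h y) y"
      have "\<forall>\<^sub>F y in nhds 0. y \<in> ball 0 e" using h(1) by (intro eventually_nhds_in_open) auto
      then have "\<forall>\<^sub>F y in nhds 0. y\<^sup>2 = surf_poly (h y)" by eventually_elim (rule h(4))
      moreover have "h analytic_on {0}" using h by (auto intro: holomorphic_on_imp_analytic_at)
      ultimately have "reg ?r 0" unfolding reg_def areg_def by auto
      then have "\<forall>\<^sub>F y in nhds 0. ?r y \<in> S" using openin_atlasD[OF S(1)] S(2) h(3) by simp
      then obtain d where d: "d > 0" "\<And>y. y \<in> ball 0 d \<Longrightarrow> ?r y \<in> S"
        by (auto simp: eventually_nhds_metric dist_commute)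
      define y :: complex where "y = of_real (min d e / 2)"
      have y: "y \<in> ball 0 d" "- y \<in> ball 0 d" "y \<in> ball 0 e" "y \<noteq> 0"
        using d(1) h(1) by (auto simp: y_def)
      have P: "surf_poly (h y) = y\<^sup>2" using h(4)[OF y(3)] by simp
      have "h y \<in> E S"
        using d(2)[OF y(1)] d(2)[OF y(2)] h(5) y(4) by (auto simp: E_def W_def P power2_eq_iff)
      then show ?thesis by blast
    qed
    have "Affine w0 0 \<in> surf" using w0 by simp
    then have "Affine w0 0 \<in> T \<or> Affine w0 0 \<in> T'" using T(3) by blast
    then have ne: "E T \<union> E T' \<noteq> {}" using near T(1,2) by blast
    have sub: "E T \<subseteq> W" "E T' \<subseteq> W" "N \<subseteq> W" by (auto simp: E_def N_def)
    have "N = {}"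
      using connectedD[OF conW open_Un[OF openE[OF T(1)] openE[OF T(2)]] openN] dis1 cover ne sub
      by blast
    then have "E T = {} \<or> E T' = {}"
      using connectedD[OF conW openE[OF T(1)] openE[OF T(2)]] dis2 cover sub by blast
    moreover have "E S \<noteq> {}" if S: "S = T \<or> S = T'" for S
    proof -
      obtain p where "p \<in> S" using S T(5,6) by blast
      then obtain q where q: "q \<in> S" "good q" using open_has_good S T(1,2) by metis
      define w where "w = fun_w q"
      have "q = Affine w (fun_y q)" "(fun_y q)\<^sup>2 = surf_poly w" "fun_y q \<noteq> 0"
        using q(2) affine_eq affine_poly by (auto simp: good_def w_def)
      then have "w \<in> W" "\<exists>y. y\<^sup>2 = surf_poly w \<and> Affine w y \<in> S" using q(1) by (auto simp: W_def)
      then have "w \<in> E S" using cover \<open>N = {}\<close> S T(4) unfolding E_def by blast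
      then show ?thesis by blast
    qed
    ultimately show False by blast
  qed
  then show ?thesis unfolding connected_space_def topspace_atlas
    using openin_subset[of ?X, unfolded topspace_atlas] by (metis Un_least subset_antisym)
qed

theorem surf_riemann_surface: "riemann_surface surf surf_atlas"
  unfolding riemann_surface_def using surf_complex_atlas surf_Hausdorff surf_connected by blast

subsection \<open>The automorphism and the forms\<close>

lemma sigma_coords [simp]:
  "fun_w (sigma_aut p) = \<i> * fun_w p" "fun_y (sigma_aut p) = fun_y p"
  "fun_u (sigma_aut p) = - \<i> * fun_u p" "fun_v (sigma_aut p) = fun_v p"
proof -
  have "\<i> ^ 4 = 1" by (simp add: power_numeral_even)
  then show "fun_v (sigma_aut p) = fun_v p" by (cases p) (auto simp: power_mult_distrib)
qed (cases p; simp add: divide_simps)+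

lemma surf_poly_i [simp]: "surf_poly (\<i> * w) = surf_poly w"
proof -
  have "\<i> ^ 4 = 1" "\<i> ^ 8 = 1" by (simp_all add: power_numeral_even)
  then show ?thesis by (simp add: surf_poly_def power_mult_distrib)
qed

lemma sigma_pts [simp]:
  "sigma_aut p \<in> affine_pts \<longleftrightarrow> p \<in> affine_pts"
  "sigma_aut p \<in> outer_pts \<longleftrightarrow> p \<in> outer_pts"
  "sigma_aut p \<in> surf \<longleftrightarrow> p \<in> surf"
  by (cases p; simp)+

lemma sigma_good [simp]: "good (sigma_aut p) \<longleftrightarrow> good p"
  by (simp add: good_def)

lemma sigma_reg: "reg r z \<Longrightarrow> reg (\<lambda>t. sigma_aut (r t)) z"
  unfolding reg_def areg_def ireg_def by (auto intro!: analytic_intros)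

lemma sigma_4: "sigma_aut (sigma_aut (sigma_aut (sigma_aut p))) = p"
  by (cases p) auto

lemma holomorphic_map_regI:
  assumes "F ` surf \<subseteq> surf" "\<And>r z. reg r z \<Longrightarrow> reg (\<lambda>t. F (r t)) z"
  shows "holomorphic_map surf surf_atlas surf surf_atlas F"
proof -
  have "open (\<phi> ` (U \<inter> F -` V)) \<and>
        (\<psi> \<circ> F \<circ> inv_into U \<phi>) holomorphic_on \<phi> ` (U \<inter> F -` V)"
    if c: "(U, \<phi>) \<in> surf_atlas" "(V, \<psi>) \<in> surf_atlas" for U \<phi> V \<psi>
  proof
    show "open (\<phi> ` (U \<inter> F -` V))"
    proof (rule chart_open_evI[OF c(1)])
      fix z assume z: "z \<in> \<phi> ` U" "inv_into U \<phi> z \<in> F -` V"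
      have "\<forall>\<^sub>F t in nhds z. F (inv_into U \<phi> t) \<in> V"
        using reg_in_chart(1)[OF c(2) assms(2)[OF chart_reg[OF c(1) z(1)]]] z(2) by simp
      then show "\<forall>\<^sub>F t in nhds z. inv_into U \<phi> t \<in> F -` V" by simp
    qed
    show "(\<psi> \<circ> F \<circ> inv_into U \<phi>) holomorphic_on \<phi> ` (U \<inter> F -` V)"
    proof (rule holomorphic_evI)
      fix z assume "z \<in> \<phi> ` (U \<inter> F -` V)"
      then have "z \<in> \<phi> ` U" "F (inv_into U \<phi> z) \<in> V" by (auto simp: chart_image[OF c(1)])
      then show "(\<psi> \<circ> F \<circ> inv_into U \<phi>) analytic_on {z}"
        using reg_in_chart(2)[OF c(2) assms(2)[OF chart_reg[OF c(1)]]] by (simp add: o_def)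
    qed
  qed
  then show ?thesis unfolding holomorphic_map_def using assms(1) by fast
qed

theorem sigma_automorphism: "surface_automorphism surf surf_atlas sigma_aut"
  unfolding surface_automorphism_def
proof (intro conjI)
  show bij: "bij_betw sigma_aut surf surf"
    by (rule bij_betwI[where g = "\<lambda>p. sigma_aut (sigma_aut (sigma_aut p))"]) (auto simp: sigma_4)
  show "holomorphic_map surf surf_atlas surf surf_atlas sigma_aut"
    by (rule holomorphic_map_regI) (auto intro: sigma_reg)
  have inv: "inv_into surf sigma_aut p = sigma_aut (sigma_aut (sigma_aut p))" if "p \<in> surf" for p
    using bij that by (intro inv_into_f_eq) (auto simp: bij_betw_def sigma_4)
  show "holomorphic_map surf surf_atlas surf surf_atlas (inv_into surf sigma_aut)"
  proof (rule holomorphic_map_regI)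
    show "inv_into surf sigma_aut ` surf \<subseteq> surf" by (auto simp: inv)
    fix r z assume r: "reg r z"
    have "\<forall>\<^sub>F t in nhds z. sigma_aut (sigma_aut (sigma_aut (r t))) = inv_into surf sigma_aut (r t)"
      using reg_surf[OF r] by eventually_elim (simp add: inv)
    then show "reg (\<lambda>t. inv_into surf sigma_aut (r t)) z"
      by (rule reg_cong) (intro sigma_reg r)
  qed
qed

text \<open>The forms \<open>(a + b \<omega> + c \<omega>\<^sup>2) / y d\<omega>\<close>.\<close>

definition qfun :: "complex \<Rightarrow> complex \<Rightarrow> complex \<Rightarrow> surf_point \<Rightarrow> complex" where
  "qfun a b c p = (a + b * fun_w p + c * (fun_w p)\<^sup>2) / fun_y p"

definition qform :: "complex \<Rightarrow> complex \<Rightarrow> complex \<Rightarrow> surf_point one_form" where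
  "qform a b c = differential surf_atlas (qfun a b c) fun_w"

lemma Phi_qform:
  "Phi1 l = qform 1 0 (- (1 + l\<^sup>2))" "Phi2 l = qform \<i> 0 (\<i> * (1 + l\<^sup>2))"
  "Phi3 l = qform 0 2 0" "Phi4 l = qform 0 (2 * l) 0"
  unfolding Phi1_def Phi2_def Phi3_def Phi4_def qform_def
  by (rule arg_cong[where f = "\<lambda>f. differential surf_atlas f fun_w"], simp add: qfun_def fun_eq_iff algebra_simps)+

lemma deriv_eq_on:
  assumes "(F has_field_derivative d) (at t)" "open S" "t \<in> S" "\<And>x. x \<in> S \<Longrightarrow> F x = G x"
  shows "deriv G t = (d :: complex)"
  using has_field_derivative_transform_within_open[OF assms] DERIV_imp_deriv by blast

lemma coeff_extends:
  assumes c: "(U, \<phi>) \<in> surf_atlas" "z \<in> \<phi> ` U"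
  obtains k where "k analytic_on {z}"
    "\<forall>\<^sub>F t in at z. qfun a b c (inv_into U \<phi> t) * deriv (fun_w \<circ> inv_into U \<phi>) t = k t"
  using c(1)
proof (cases rule: atlas_cases)
  case (w s D)
  have e: "U = (\<lambda>w. Affine w (s w)) ` D" "\<phi> = fun_w" using w by auto
  have inv: "inv_into U \<phi> t = Affine t (s t)" if "t \<in> D" for t
    using that by (simp add: e section_props(3)[of D fun_w "\<lambda>w. Affine w (s w)"])
  have z: "z \<in> D" using c(2) by (auto simp: e)
  have ev: "\<forall>\<^sub>F t in at z. t \<in> D" using z w(2) eventually_at_in_open' by blast
  have an: "s analytic_on {z}" using w z by (auto intro: holomorphic_on_imp_analytic_at)
  show thesis
  proof (rule that)
    show "(\<lambda>t. (a + b * t + c * t\<^sup>2) / s t) analytic_on {z}"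
      using an w_section_nz[OF w(2-4) z] by (auto intro!: analytic_intros)
    show "\<forall>\<^sub>F t in at z. qfun a b c (inv_into U \<phi> t) * deriv (fun_w \<circ> inv_into U \<phi>) t
            = (a + b * t + c * t\<^sup>2) / s t"
      using ev
    proof eventually_elim
      case (elim t)
      have "deriv (fun_w \<circ> inv_into U \<phi>) t = 1"
        by (rule deriv_eq_on[OF DERIV_ident w(2) elim]) (simp add: inv)
      then show ?case by (simp add: inv elim qfun_def)
    qed
  qed
next
  case (y h D)
  have e: "U = (\<lambda>y. Affine (h y) y) ` D" "\<phi> = fun_y" using y by auto
  have inv: "inv_into U \<phi> t = Affine (h t) t" if "t \<in> D" for t
    using that by (simp add: e section_props(3)[of D fun_y "\<lambda>y. Affine (h y) y"])
  have z: "z \<in> D" using c(2) by (auto simp: e)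
  have ev: "\<forall>\<^sub>F t in at z. t \<in> D" using z y(2) eventually_at_in_open' by blast
  have an: "h analytic_on {z}" using y z by (auto intro: holomorphic_on_imp_analytic_at)
  show thesis
  proof (rule that)
    show "(\<lambda>t. (a + b * h t + c * (h t)\<^sup>2) * 2 / surf_poly' (h t)) analytic_on {z}"
      using an y_section(2)[OF y(2-4) z]
      unfolding surf_poly'_def by (intro analytic_intros) auto
    show "\<forall>\<^sub>F t in at z. qfun a b c (inv_into U \<phi> t) * deriv (fun_w \<circ> inv_into U \<phi>) t
            = (a + b * h t + c * (h t)\<^sup>2) * 2 / surf_poly' (h t)"
      using ev ev_at_ident[of 0 z]
    proof eventually_elim
      case (elim t)
      have "(h has_field_derivative deriv h t) (at t)"
        using y elim by (auto intro: holomorphic_derivI)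
      then have "deriv (fun_w \<circ> inv_into U \<phi>) t = deriv h t"
        by (rule deriv_eq_on[OF _ y(2) elim(1)]) (simp add: inv)
      moreover have "deriv h t = 2 * t / surf_poly' (h t)"
        using y_section[OF y(2-4) elim(1)] by (simp add: field_simps)
      ultimately show ?case using elim by (simp add: inv qfun_def)
    qed
  qed
next
  case (u s D)
  have e: "U = (\<lambda>u. point_uv u (s u)) ` D" "\<phi> = fun_u" using u by auto
  have inv: "inv_into U \<phi> t = point_uv t (s t)" if "t \<in> D" for t
    using that by (simp add: e section_props(3)[of D fun_u "\<lambda>u. point_uv u (s u)"])
  have z: "z \<in> D" using c(2) by (auto simp: e)
  have ev: "\<forall>\<^sub>F t in at z. t \<in> D" using z u(2) eventually_at_in_open' by blast
  have an: "s analytic_on {z}" using u z by (auto intro: holomorphic_on_imp_analytic_at)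
  show thesis
  proof (rule that)
    show "(\<lambda>t. - (a * t\<^sup>2 + b * t + c) / s t) analytic_on {z}"
      using an u_section_nz[OF u(2-4) z] by (auto intro!: analytic_intros)
    show "\<forall>\<^sub>F t in at z. qfun a b c (inv_into U \<phi> t) * deriv (fun_w \<circ> inv_into U \<phi>) t
            = - (a * t\<^sup>2 + b * t + c) / s t"
      using ev ev_at_ident[of 0 z]
    proof eventually_elim
      case (elim t)
      have op: "open (D - {0})" "t \<in> D - {0}" using u(2) elim by auto
      have "((\<lambda>t. 1 / t) has_field_derivative (- 1 / t\<^sup>2)) (at t)"
        using elim by (auto intro!: derivative_eq_intros simp: power2_eq_square)
      then have d: "deriv (fun_w \<circ> inv_into U \<phi>) t = - 1 / t\<^sup>2"
        by (rule deriv_eq_on[OF _ op]) (simp add: inv point_uv_def)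
      have "t ^ 4 = t\<^sup>2 * t\<^sup>2" by (simp flip: power_add)
      moreover have "s t \<noteq> 0" using u_section_nz[OF u(2-4) elim(1)] .
      ultimately show ?case
        using elim unfolding d by (simp add: inv qfun_def point_uv_def field_simps power2_eq_square)
    qed
  qed
qed

lemma qform_coeff:
  assumes c: "(U, \<phi>) \<in> surf_atlas" "z \<in> \<phi> ` U"
  shows "qform a b c (U, \<phi>) analytic_on {z}"
    "(\<lambda>t. qfun a b c (inv_into U \<phi> t) * deriv (fun_w \<circ> inv_into U \<phi>) t) \<midarrow>z\<rightarrow> qform a b c (U, \<phi>) z"
proof -
  let ?f = "\<lambda>t. qfun a b c (inv_into U \<phi> t) * deriv (fun_w \<circ> inv_into U \<phi>) t"
  obtain k where k: "k analytic_on {z}" "\<forall>\<^sub>F t in at z. ?f t = k t"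
    by (rule coeff_extends[OF c])
  obtain S where S: "open S" "z \<in> S" "k holomorphic_on S" using k(1) by (auto simp: analytic_at)
  obtain T where T: "open T" "z \<in> T" "\<And>t. t \<in> T \<Longrightarrow> t \<noteq> z \<Longrightarrow> ?f t = k t"
    using k(2) unfolding eventually_at_topological by blast
  have lim: "?f \<midarrow>t\<rightarrow> k t" if t: "t \<in> S \<inter> T" for t
  proof -
    have "isCont k t" using S t by (auto intro: analytic_at_imp_isCont holomorphic_on_imp_analytic_at)
    then have "k \<midarrow>t\<rightarrow> k t" by (simp add: isCont_def)
    moreover have "\<forall>\<^sub>F x in at t. x \<in> T" using t T(1) eventually_at_in_open' by blast
    then have "\<forall>\<^sub>F x in at t. k x = ?f x"
      using ev_at_ident[of z t] by eventually_elim (simp add: T(3))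
    ultimately show ?thesis by (rule Lim_transform_eventually)
  qed
  have eq: "qform a b c (U, \<phi>) t = k t" if "t \<in> S \<inter> T" "t \<in> \<phi> ` U" for t
    using remove_sings_eqI[OF lim[OF that(1)]] that(2) c(1) by (simp add: qform_def differential_def)
  show "?f \<midarrow>z\<rightarrow> qform a b c (U, \<phi>) z" using lim eq c S T by auto
  have "\<forall>\<^sub>F t in nhds z. t \<in> S \<inter> T" using S T by (intro eventually_nhds_in_open) auto
  then have "\<forall>\<^sub>F t in nhds z. k t = qform a b c (U, \<phi>) t"
    using ev_chart[OF c] by eventually_elim (simp add: eq)
  then show "qform a b c (U, \<phi>) analytic_on {z}" by (rule an_cong[OF k(1)])
qed

lemma reg_near: "reg r z \<Longrightarrow> \<forall>\<^sub>F t in nhds z. reg r t"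
proof -
  have an: "\<forall>\<^sub>F t in nhds z. f analytic_on {t}" if f: "f analytic_on {z}" for f :: "complex \<Rightarrow> complex"
  proof -
    obtain S where S: "open S" "z \<in> S" "f holomorphic_on S" using f by (auto simp: analytic_at)
    then have "\<forall>\<^sub>F t in nhds z. t \<in> S" by (intro eventually_nhds_in_open)
    then show ?thesis by eventually_elim (use S in \<open>auto simp: analytic_at\<close>)
  qed
  have ev: "\<forall>\<^sub>F t in nhds z. \<forall>\<^sub>F x in nhds t. P x" if "\<forall>\<^sub>F t in nhds z. P t" for P :: "complex \<Rightarrow> bool"
    using that by (simp add: eventually_eventually)
  assume "reg r z"
  then consider "areg r z" | "ireg r z" by (auto simp: reg_def)
  then show ?thesis
  proof cases
    case 1
    then have "\<forall>\<^sub>F t in nhds z. areg r t"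
      unfolding areg_def by (intro eventually_conj an ev) auto
    then show ?thesis by eventually_elim (simp add: reg_def)
  next
    case 2
    then have "\<forall>\<^sub>F t in nhds z. ireg r t"
      unfolding ireg_def by (intro eventually_conj an ev) auto
    then show ?thesis by eventually_elim (simp add: reg_def)
  qed
qed

lemma qfun_analytic:
  assumes "areg r z" "fun_y (r z) \<noteq> 0"
  shows "(\<lambda>t. qfun a b c (r t)) analytic_on {z}"
  using assms unfolding areg_def qfun_def by (intro analytic_intros) auto

lemma qform_good:
  assumes c: "(U, \<phi>) \<in> surf_atlas" "z \<in> \<phi> ` U" and g: "good (inv_into U \<phi> z)"
  shows "qform a b c (U, \<phi>) z = qfun a b c (inv_into U \<phi> z) * deriv (fun_w \<circ> inv_into U \<phi>) z"
proof -
  have ar: "areg (inv_into U \<phi>) z" using reg_areg[OF chart_reg[OF c]] g by (simp add: good_def)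
  then have "(fun_w \<circ> inv_into U \<phi>) analytic_on {z}" by (simp add: areg_def o_def)
  moreover have "(\<lambda>t. qfun a b c (inv_into U \<phi> t)) analytic_on {z}"
    using qfun_analytic[OF ar] g by (simp add: good_def)
  ultimately have "(\<lambda>t. qfun a b c (inv_into U \<phi> t) * deriv (fun_w \<circ> inv_into U \<phi>) t) analytic_on {z}"
    by (intro analytic_intros)
  then have "(\<lambda>t. qfun a b c (inv_into U \<phi> t) * deriv (fun_w \<circ> inv_into U \<phi>) t) \<midarrow>z\<rightarrow>
       qfun a b c (inv_into U \<phi> z) * deriv (fun_w \<circ> inv_into U \<phi>) z"
    using analytic_at_imp_isCont isContD by blast
  then show ?thesis using qform_coeff(2)[OF c] LIM_unique by blast
qed

text \<open>The coefficient of a form along a local holomorphic curve is computed by any chart.\<close>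

lemma qform_along:
  assumes c: "(V, \<psi>) \<in> surf_atlas" and r: "reg r z" "r z \<in> V" and g: "\<forall>\<^sub>F t in at z. good (r t)"
  shows "(\<lambda>t. qfun a b c (r t) * deriv (fun_w \<circ> r) t) \<midarrow>z\<rightarrow>
           qform a b c (V, \<psi>) (\<psi> (r z)) * deriv (\<lambda>t. \<psi> (r t)) z"
proof -
  let ?\<tau> = "\<lambda>t. \<psi> (r t)"
  have \<tau>: "?\<tau> analytic_on {z}" and V: "\<forall>\<^sub>F t in nhds z. r t \<in> V" using reg_in_chart[OF c r] by auto
  have "qform a b c (V, \<psi>) analytic_on {?\<tau> z}" using qform_coeff(1)[OF c] r(2) by blast
  then have "(\<lambda>t. qform a b c (V, \<psi>) (?\<tau> t)) analytic_on {z}"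
    using analytic_on_compose[OF \<tau>] by (simp add: o_def)
  then have "(\<lambda>t. qform a b c (V, \<psi>) (?\<tau> t) * deriv ?\<tau> t) analytic_on {z}"
    using \<tau> by (intro analytic_intros)
  then have lim: "(\<lambda>t. qform a b c (V, \<psi>) (?\<tau> t) * deriv ?\<tau> t) \<midarrow>z\<rightarrow>
      qform a b c (V, \<psi>) (?\<tau> z) * deriv ?\<tau> z"
    using analytic_at_imp_isCont isContD by blast
  have "\<forall>\<^sub>F t in at z. qform a b c (V, \<psi>) (?\<tau> t) * deriv ?\<tau> t = qfun a b c (r t) * deriv (fun_w \<circ> r) t"
    using g ev_at_nhds[OF V] ev_at_nhds[OF reg_near[OF r(1)]]
  proof eventually_elim
    case (elim t)
    have t: "?\<tau> t \<in> \<psi> ` V" "inv_into V \<psi> (?\<tau> t) = r t" using elim(2) chart_inj_open[OF c] by auto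
    have "areg (inv_into V \<psi>) (?\<tau> t)"
      using reg_areg[OF chart_reg[OF c t(1)]] t(2) elim(1) by (simp add: good_def)
    then have w: "(fun_w \<circ> inv_into V \<psi>) analytic_on {?\<tau> t}" by (simp add: areg_def o_def)
    have \<tau>t: "?\<tau> analytic_on {t}" and Vt: "\<forall>\<^sub>F x in nhds t. r x \<in> V"
      using reg_in_chart[OF c elim(3,2)] by auto
    have "deriv (fun_w \<circ> r) t = deriv ((fun_w \<circ> inv_into V \<psi>) \<circ> ?\<tau>) t"
    proof (rule deriv_cong_ev)
      show "\<forall>\<^sub>F x in nhds t. (fun_w \<circ> r) x = ((fun_w \<circ> inv_into V \<psi>) \<circ> ?\<tau>) x"
        using Vt by eventually_elim (use chart_inj_open[OF c] in simp)
    qed simp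
    also have "\<dots> = deriv (fun_w \<circ> inv_into V \<psi>) (?\<tau> t) * deriv ?\<tau> t"
      using w \<tau>t by (intro deriv_chain) (auto intro: analytic_on_imp_differentiable_at)
    finally have d: "deriv (fun_w \<circ> r) t = deriv (fun_w \<circ> inv_into V \<psi>) (?\<tau> t) * deriv ?\<tau> t" .
    have "qform a b c (V, \<psi>) (?\<tau> t) = qfun a b c (r t) * deriv (fun_w \<circ> inv_into V \<psi>) (?\<tau> t)"
      using qform_good[OF c t(1)] t(2) elim(1) by simp
    then show ?case by (simp add: d)
  qed
  then show ?thesis by (rule Lim_transform_eventually[OF lim])
qed

lemma qform_holomorphic: "holomorphic_one_form surf_atlas (qform a b c)"
proof -
  have 1: "qform a b c (U, \<phi>) holomorphic_on \<phi> ` U" if "(U, \<phi>) \<in> surf_atlas" for U \<phi>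
    by (rule holomorphic_evI) (rule qform_coeff(1)[OF that])
  have 2: "qform a b c (U, \<phi>) z =
      qform a b c (V, \<psi>) ((\<psi> \<circ> inv_into U \<phi>) z) * deriv (\<psi> \<circ> inv_into U \<phi>) z"
    if c: "(U, \<phi>) \<in> surf_atlas" "(V, \<psi>) \<in> surf_atlas" "z \<in> \<phi> ` (U \<inter> V)" for U \<phi> V \<psi> z
  proof -
    have z: "z \<in> \<phi> ` U" "inv_into U \<phi> z \<in> V" using c(3) chart_image[OF c(1)] by auto
    show ?thesis
      using LIM_unique[OF qform_coeff(2)[OF c(1) z(1)]
          qform_along[OF c(2) chart_reg[OF c(1) z(1)] z(2) chart_good[OF c(1) z(1)]]]
      by (simp add: o_def)
  qed
  have 3: "qform a b c (U, \<phi>) z = 0" if "(U, \<phi>) \<notin> surf_atlas \<or> z \<notin> \<phi> ` U" for U \<phi> z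
    using that by (auto simp: qform_def differential_def)
  show ?thesis unfolding holomorphic_one_form_def using 1 2 3 by fast
qed

theorem Phi_holomorphic:
  "holomorphic_one_form surf_atlas (Phi1 l)" "holomorphic_one_form surf_atlas (Phi2 l)"
  "holomorphic_one_form surf_atlas (Phi3 l)" "holomorphic_one_form surf_atlas (Phi4 l)"
  unfolding Phi_qform by (rule qform_holomorphic)+

end

theory Submission
  imports Defs
begin

text \<open>On points \<open>(\<omega>, y)\<close> with \<open>y \<noteq> 0\<close> the substitution \<open>\<omega> \<mapsto> \<i> \<omega>\<close> turns
  \<open>(a + b \<omega> + c \<omega>\<^sup>2) / y d\<omega>\<close> into \<open>\<i> (a + \<i> b \<omega> - c \<omega>\<^sup>2) / y d\<omega>\<close>.  Such points are dense in every
  chart, and the coefficients of both forms at the remaining points (branch points and points over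
  infinity) are limits of those at these points, so the two forms agree everywhere.\<close>

lemma qform_scale:
  "qform (k * a) (k * b) (k * c) = (\<lambda>ch z. k * qform a b c ch z)"
proof (intro ext)
  fix ch :: "surf_point chart" and z
  obtain U \<phi> where ch: "ch = (U, \<phi>)" by (cases ch)
  show "qform (k * a) (k * b) (k * c) ch z = k * qform a b c ch z"
  proof (cases "(U, \<phi>) \<in> surf_atlas \<and> z \<in> \<phi> ` U")
    case True
    then have c: "(U, \<phi>) \<in> surf_atlas" "z \<in> \<phi> ` U" by auto
    have "qfun (k * a) (k * b) (k * c) p = k * qfun a b c p" for p
      by (simp add: qfun_def algebra_simps)
    \<comment> \<open>At a singular point the coefficient is known only as a limit, so uniqueness of
      limits has to carry the factor over.\<close>
    then show ?thesis
      using LIM_unique[OF qform_coeff(2)[OF c, of "k * a" "k * b" "k * c"]]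
        tendsto_mult_left[OF qform_coeff(2)[OF c, of a b c], of k]
      by (simp add: ch mult.assoc)
  next
    case False
    then show ?thesis by (auto simp: ch qform_def differential_def)
  qed
qed

lemma qform_uminus: "qform (- a) (- b) (- c) = - qform a b c"
  using qform_scale[of "- 1" a b c] by (simp add: fun_eq_iff)

text \<open>Since \<sigma> fixes y and multiplies both \<omega> and d\<omega> by \<i>, the terms of
  degree 0, 1 and 2 in \<omega> pick up the factors \<i>, \<i>^2 = -1 and \<i>^3 = -\<i>.\<close>

lemma pullback_sigma_qform:
  "pullback surf_atlas surf_atlas sigma_aut (qform a b c) = qform (\<i> * a) (- b) (- \<i> * c)"
proof (intro ext)
  fix ch :: "surf_point chart" and z
  obtain U \<phi> where ch: "ch = (U, \<phi>)" by (cases ch)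
  show "pullback surf_atlas surf_atlas sigma_aut (qform a b c) ch z =
      qform (\<i> * a) (- b) (- \<i> * c) ch z"
  proof (cases "(U, \<phi>) \<in> surf_atlas \<and> z \<in> \<phi> ` U")
    case True
    then have c: "(U, \<phi>) \<in> surf_atlas" "z \<in> \<phi> ` U" by auto
    let ?p = "inv_into U \<phi>"
    let ?s = "\<lambda>t. sigma_aut (?p t)"
    \<comment> \<open>This is the chart chosen in \<open>pullback\<close>. All that matters is that
      it contains the image point, because \<open>qform_along\<close> holds for every such
      chart.\<close>
    let ?choice = "SOME ch. ch \<in> surf_atlas \<and> ?s z \<in> fst ch"
    have reg: "reg ?p z" by (rule chart_reg[OF c])
    have "?s z \<in> surf" using ev_at[OF reg_surf[OF reg]] by simp
    then have "\<exists>ch. ch \<in> surf_atlas \<and> ?s z \<in> fst ch" using surf_cover by blast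
    then have "?choice \<in> surf_atlas \<and> ?s z \<in> fst ?choice" by (rule someI_ex)
    moreover obtain V \<psi> where V: "?choice = (V, \<psi>)" by (cases ?choice)
    ultimately have V_atlas: "(V, \<psi>) \<in> surf_atlas" "?s z \<in> V" by auto
    have good: "\<forall>\<^sub>F t in at z. good (?p t)" by (rule chart_good[OF c])
    \<comment> \<open>The limit is the coefficient of the pullback at \<open>z\<close>; the left
      side no longer mentions the chosen chart.\<close>
    have lim: "(\<lambda>t. qfun a b c (?s t) * deriv (fun_w \<circ> ?s) t) \<midarrow>z\<rightarrow>
        qform a b c (V, \<psi>) (\<psi> (?s z)) * deriv (\<lambda>t. \<psi> (?s t)) z"
      using good by (intro qform_along V_atlas sigma_reg reg) simp
    have "\<forall>\<^sub>F t in at z. qfun a b c (?s t) * deriv (fun_w \<circ> ?s) t =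
        qfun (\<i> * a) (- b) (- \<i> * c) (?p t) * deriv (fun_w \<circ> ?p) t"
      using good ev_at_nhds[OF reg_near[OF reg]]
    proof eventually_elim
      case (elim t)
      \<comment> \<open>\<open>deriv_cmult\<close> needs \<omega> to be differentiable along the
        chart at \<open>t\<close>, which holds because \<open>?p t\<close> is an affine
        point.\<close>
      have "areg ?p t" using reg_areg elim by (simp add: good_def)
      then have "(\<lambda>t. fun_w (?p t)) field_differentiable at t"
        unfolding areg_def by (auto intro: analytic_on_imp_differentiable_at)
      then have "deriv (fun_w \<circ> ?s) t = \<i> * deriv (fun_w \<circ> ?p) t"
        by (simp add: o_def deriv_cmult)
      moreover have "qfun a b c (?s t) * \<i> = qfun (\<i> * a) (- b) (- \<i> * c) (?p t)"
        by (simp add: qfun_def algebra_simps)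
      ultimately show ?case by (simp flip: mult.assoc)
    qed
    from LIM_unique[OF Lim_transform_eventually[OF lim this] qform_coeff(2)[OF c]]
    show ?thesis using c V by (simp add: ch pullback_def Let_def o_def)
  next
    case False
    \<comment> \<open>Off the atlas both sides are 0 by convention.\<close>
    then show ?thesis by (auto simp: ch pullback_def qform_def differential_def)
  qed
qed

text \<open>The sort \<open>zero\<close> covers both the complex rows of \<open>M_sigma\<close> and
  the vector \<open>Phi l\<close>, whose entries are functions.\<close>

lemma vector_4 [simp]:
  "(vector [a, b, c, d] :: 'a::zero^4) $ 1 = a"
  "(vector [a, b, c, d] :: 'a::zero^4) $ 2 = b"
  "(vector [a, b, c, d] :: 'a::zero^4) $ 3 = c"
  "(vector [a, b, c, d] :: 'a::zero^4) $ 4 = d"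
  by (simp_all add: vector_def)

theorem lemma10p1:
  fixes l :: complex
  shows "(pullback surf_atlas surf_atlas sigma_aut (Phi1 l) = Phi2 l \<and>
          pullback surf_atlas surf_atlas sigma_aut (Phi2 l) = - Phi1 l \<and>
          pullback surf_atlas surf_atlas sigma_aut (Phi3 l) = - Phi3 l \<and>
          pullback surf_atlas surf_atlas sigma_aut (Phi4 l) = - Phi4 l) \<and>
         (\<chi> j. pullback surf_atlas surf_atlas sigma_aut (Phi l $ j)) = mat_mult_forms M_sigma (Phi l) \<and>
         unitary_matrix M_sigma"
proof -
  have forms: "pullback surf_atlas surf_atlas sigma_aut (Phi1 l) = Phi2 l"
    "pullback surf_atlas surf_atlas sigma_aut (Phi2 l) = - Phi1 l"
    "pullback surf_atlas surf_atlas sigma_aut (Phi3 l) = - Phi3 l"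
    "pullback surf_atlas surf_atlas sigma_aut (Phi4 l) = - Phi4 l"
    by (simp_all add: Phi_qform pullback_sigma_qform algebra_simps flip: qform_uminus)
  moreover have "(\<chi> j. pullback surf_atlas surf_atlas sigma_aut (Phi l $ j)) =
      mat_mult_forms M_sigma (Phi l)"
    by (simp add: vec_eq_iff forall_4 Phi_def mat_mult_forms_def M_sigma_def sum_4 forms fun_eq_iff)
  moreover have "unitary_matrix M_sigma"
    by (simp add: unitary_matrix_def M_sigma_def vec_eq_iff forall_4 matrix_matrix_mult_def
        sum_4 mat_def)
  ultimately show ?thesis by blast
qed

end
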